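(* Let $A\Rightarrow M$ be a Lie algebroid with a bundle of ideals $\mathfrak k$ and an IM connection $(\mathcal C,v)\in\mathcal A(A;\mathfrak k)$. For any horizontal IM form $(L,l)\in\Omega^1_{im}(A;\mathfrak k)^{\mathrm{Hor}}$ and $\lambda\in\mathbb R$, $$\Omega^{(\mathcal C,v)+\lambda(L,l)}=\Omega^{(\mathcal C,v)}+\lambda D^{(\mathcal C,v)}(L,l)+\lambda^2\mathbf c_2(L,l),$$ where the second-order coefficient is given by the map $$\mathbf c_2\colon\Omega^1_{im}(A;\mathfrak k)^{\mathrm{Hor}}\to\Omega^2_{im}(A;\mathfrak k)^{\mathrm{Hor}},\qquad \mathbf c_2(L,l)(\alpha)=-\big(L|_{\mathfrak k}\dot\wedge L\alpha,\ L|_{\mathfrak k}\cdot l\alpha\big).$$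
   Context: $\rho$ is the anchor of $A$. A bundle of ideals is a vector subbundle $\mathfrak k\subset\ker\rho\subset A$ with $[\Gamma(A),\Gamma(\mathfrak k)]\subset\Gamma(\mathfrak k)$. $W^{1,q}(A;\mathfrak k)$ consists of pairs $c=(c_0,c_1)$, $c_0\colon\Gamma(A)\to\Omega^q(M;\mathfrak k)$ $\mathbb R$-linear, $c_1\colon\Gamma(A)\to\Omega^{q-1}(M;\mathfrak k)$ $C^\infty(M)$-linear, with $c_0(f\alpha)=fc_0(\alpha)+\mathrm df\wedge c_1(\alpha)$; write $c(\alpha)=(c_0(\alpha),c_1(\alpha))$. With $(\mathcal L^A_\alpha\gamma)(\underline X)=[\alpha,\gamma(\underline X)]-\sum_j\gamma(\dots,[\rho(\alpha),X_j],\dots)$, $c$ is an IM form, $c\in\Omega^q_{im}(A;\mathfrak k)$, if $c_0[\alpha,\beta]=\mathcal L^A_\alpha c_0(\beta)-\mathcal L^A_\beta c_0(\alpha)$, $c_1[\alpha,\beta]=\mathcal L^A_\alpha c_1(\beta)-\iota_{\rho(\beta)}c_0(\alpha)$, $\iota_{\rho(\alpha)}c_1(\beta)=-\iota_{\rho(\beta)}c_1(\alpha)$; it is horizontal (superscript $\mathrm{Hor}$) if $c_1|_{\mathfrak k}=0$. $\mathcal A(A;\mathfrak k)$, the set of IM connections, consists of $(\mathcal C,v)\in\Omega^1_{im}(A;\mathfrak k)$ with $v|_{\mathfrak k}=\mathrm{id}$. Put $h=\mathrm{id}_A-v$ and $\nabla_X\xi=\mathcal C(\xi)(X)$, a linear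 connection on $\mathfrak k$. For a $C^\infty(M)$-linear map $\kappa\colon\Gamma(\mathfrak k)\to\Omega^k(M;\mathfrak k)$ and $\vartheta\in\Omega^1(M;\mathfrak k)$ let $(\kappa\dot\wedge\vartheta)(X_0,\dots,X_k)=\sum_i(-1)^i\kappa(\vartheta(X_i))(X_0,\dots,\widehat{X_i},\dots,X_k)$. For $c\in W^{1,q}(A;\mathfrak k)$, $$(D^{(\mathcal C,v)}c)_0(\alpha)=\mathrm d^\nabla c_0(\alpha)-\kappa|_{\mathfrak k}\dot\wedge\mathcal C\alpha,\quad(D^{(\mathcal C,v)}c)_1(\beta)=\kappa(h\beta),\quad\kappa(\beta)=c_0(\beta)-\mathrm d^\nabla(c_1(\beta)).$$ The curvature is $\Omega^{(\mathcal C,v)}=D^{(\mathcal C,v)}(\mathcal C,v)$. For horizontal $(L,l)$ the restriction $L|_{\mathfrak k}\colon\Gamma(\mathfrak k)\to\Omega^1(M;\mathfrak k)$ is $C^\infty(M)$-linear, and $L|_{\mathfrak k}\cdot\xi=L(\xi)$. *)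

theory Defs
  imports "HOL-Analysis.Analysis" "HOL-Library.Function_Algebras" "HOL-Library.FuncSet"
begin

(* Pointwise vector space structure on functions. Sections, vector fields, differential forms
   and Weil cochains are all (iterated, paired) functions into a real vector space, so their sums
   and real multiples are the pointwise ones. *)

instantiation "fun" :: (type, real_vector) real_vector
begin

definition scaleR_fun_def: "scaleR r f = (\<lambda>x. r *\<^sub>R f x)"

instance
  by standard (simp_all add: scaleR_fun_def plus_fun_def scaleR_add_left scaleR_add_right)

end

(* Multiplication of a section or a vector field by a function. *)

definition smul :: "('m \<Rightarrow> real) \<Rightarrow> ('m \<Rightarrow> 'b::real_vector) \<Rightarrow> 'm \<Rightarrow> 'b"  (infixr "\<odot>" 75)
  where "f \<odot> s = (\<lambda>p. f p *\<^sub>R s p)"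


section \<open>Smooth manifolds\<close>

(* R^n is the library's Euclidean_space n, whose points are the sequences x :: nat => real with
   x i = 0 for i >= n; this includes n = 0. W is meant to be an open subset of it. *)

primrec C_k :: "nat \<Rightarrow> nat \<Rightarrow> (nat \<Rightarrow> real) set \<Rightarrow> ((nat \<Rightarrow> real) \<Rightarrow> real) \<Rightarrow> bool" where
  "C_k n 0 W f \<longleftrightarrow> continuous_on W f"
| "C_k n (Suc k) W f \<longleftrightarrow> continuous_on W f \<and>
     (\<forall>i<n. (\<forall>x\<in>W. (\<lambda>t. f (x(i := t))) differentiable (at (x i))) \<and>
            C_k n k W (\<lambda>x. deriv (\<lambda>t. f (x(i := t))) (x i)))"

definition C_inf :: "nat \<Rightarrow> (nat \<Rightarrow> real) set \<Rightarrow> ((nat \<Rightarrow> real) \<Rightarrow> real) \<Rightarrow> bool"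
  where "C_inf n W f \<longleftrightarrow> (\<forall>k. C_k n k W f)"

(* The underlying topological space is the whole type 'm; a chart is a pair of its domain and
   its coordinate map. *)

record 'm manifold =
  mdim :: nat
  charts :: "('m set \<times> ('m \<Rightarrow> nat \<Rightarrow> real)) set"

definition smooth_manifold ::
    "('m::{t2_space,second_countable_topology}, 'z) manifold_scheme \<Rightarrow> bool"
  where "smooth_manifold M \<longleftrightarrow>
    (\<forall>(U, \<phi>) \<in> charts M. open U \<and> openin (Euclidean_space (mdim M)) (\<phi> ` U) \<and>
        homeomorphic_map (top_of_set U) (subtopology (Euclidean_space (mdim M)) (\<phi> ` U)) \<phi>) \<and>
    (\<Union>(U, \<phi>) \<in> charts M. U) = UNIV \<and>
    (\<forall>(U, \<phi>) \<in> charts M. \<forall>(V, \<psi>) \<in> charts M. \<forall>i < mdim M.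
        C_inf (mdim M) (\<phi> ` (U \<inter> V)) (\<lambda>x. \<psi> (inv_into U \<phi> x) i))"

definition smooth_fun_on :: "('m, 'z) manifold_scheme \<Rightarrow> 'm set \<Rightarrow> ('m \<Rightarrow> real) \<Rightarrow> bool"
  where "smooth_fun_on M S f \<longleftrightarrow>
    (\<forall>(U, \<phi>) \<in> charts M. C_inf (mdim M) (\<phi> ` (U \<inter> S)) (\<lambda>x. f (inv_into U \<phi> x)))"

definition smooth_funs :: "('m, 'z) manifold_scheme \<Rightarrow> ('m \<Rightarrow> real) set"
  where "smooth_funs M = {f. smooth_fun_on M UNIV f}"

(* Tangent vectors at p are the derivations at p of the algebra of smooth functions. The value 0 on
   non-smooth functions only makes the representation by total functions unique. *)

definition tangent_space :: "('m, 'z) manifold_scheme \<Rightarrow> 'm \<Rightarrow> (('m \<Rightarrow> real) \<Rightarrow> real) set"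
  where "tangent_space M p = {u.
    (\<forall>f \<in> smooth_funs M. \<forall>g \<in> smooth_funs M. \<forall>s t. u (s *\<^sub>R f + t *\<^sub>R g) = s * u f + t * u g) \<and>
    (\<forall>f \<in> smooth_funs M. \<forall>g \<in> smooth_funs M. u (f * g) = f p * u g + g p * u f) \<and>
    (\<forall>f. f \<notin> smooth_funs M \<longrightarrow> u f = 0)}"

type_synonym 'm vfield = "'m \<Rightarrow> ('m \<Rightarrow> real) \<Rightarrow> real"

definition vf_apply :: "'m vfield \<Rightarrow> ('m \<Rightarrow> real) \<Rightarrow> 'm \<Rightarrow> real"
  where "vf_apply X f = (\<lambda>p. X p f)"

definition vfields :: "('m, 'z) manifold_scheme \<Rightarrow> 'm vfield set"
  where "vfields M = {X. (\<forall>p. X p \<in> tangent_space M p) \<and>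
    (\<forall>f \<in> smooth_funs M. vf_apply X f \<in> smooth_funs M)}"

definition vf_bracket :: "'m vfield \<Rightarrow> 'm vfield \<Rightarrow> 'm vfield"
  where "vf_bracket X Y = (\<lambda>p f. X p (vf_apply Y f) - Y p (vf_apply X f))"


section \<open>Vector bundles\<close>

(* The fibres are linear subspaces of one real vector space 'a, which carries no topology and
   serves only as a common type: the smooth structure is given by the local trivialisations alone.
   A local trivialisation over U is a family of linear isomorphisms fibre p -> R^brank, p in U. *)

record ('m, 'a) vbundle = "'m manifold" +
  brank :: nat
  fibre :: "'m \<Rightarrow> 'a set"
  trivs :: "('m set \<times> ('m \<Rightarrow> 'a \<Rightarrow> nat \<Rightarrow> real)) set"

definition vector_bundle ::
    "('m::{t2_space,second_countable_topology}, 'a::real_vector, 'z) vbundle_scheme \<Rightarrow> bool"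
  where "vector_bundle E \<longleftrightarrow> smooth_manifold E \<and>
    (\<forall>p. subspace (fibre E p)) \<and>
    (\<forall>(U, \<phi>) \<in> trivs E. open U \<and>
      (\<forall>p \<in> U.
        (\<forall>a \<in> fibre E p. \<forall>b \<in> fibre E p. \<forall>s t. \<phi> p (s *\<^sub>R a + t *\<^sub>R b) = s *\<^sub>R \<phi> p a + t *\<^sub>R \<phi> p b) \<and>
        bij_betw (\<phi> p) (fibre E p) (topspace (Euclidean_space (brank E))))) \<and>
    (\<Union>(U, \<phi>) \<in> trivs E. U) = UNIV \<and>
    (\<forall>(U, \<phi>) \<in> trivs E. \<forall>(V, \<psi>) \<in> trivs E. \<forall>i < brank E. \<forall>j < brank E.
      smooth_fun_on E (U \<inter> V)
        (\<lambda>p. \<psi> p (inv_into (fibre E p) (\<phi> p) (\<lambda>l. if l = j then 1 else 0)) i))"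

definition local_section :: "('m, 'a, 'z) vbundle_scheme \<Rightarrow> 'm set \<Rightarrow> ('m \<Rightarrow> 'a) \<Rightarrow> bool"
  where "local_section E U s \<longleftrightarrow> (\<forall>p \<in> U. s p \<in> fibre E p) \<and>
    (\<forall>(V, \<phi>) \<in> trivs E. \<forall>i < brank E. smooth_fun_on E (U \<inter> V) (\<lambda>p. \<phi> p (s p) i))"

definition sections :: "('m, 'a, 'z) vbundle_scheme \<Rightarrow> ('m \<Rightarrow> 'a) set"
  where "sections E = {s. local_section E UNIV s}"

definition vector_subbundle ::
    "('m::topological_space, 'a::real_vector, 'z) vbundle_scheme \<Rightarrow> ('m \<Rightarrow> 'a set) \<Rightarrow> bool"
  where "vector_subbundle E K \<longleftrightarrow> (\<exists>r::nat. \<forall>p. \<exists>U (e :: nat \<Rightarrow> 'm \<Rightarrow> 'a). open U \<and> p \<in> U \<and>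
    (\<forall>i<r. local_section E U (e i)) \<and>
    (\<forall>q \<in> U. inj_on (\<lambda>i. e i q) {..<r} \<and> independent ((\<lambda>i. e i q) ` {..<r}) \<and>
      span ((\<lambda>i. e i q) ` {..<r}) = K q))"

definition sub_sections :: "('m, 'a, 'z) vbundle_scheme \<Rightarrow> ('m \<Rightarrow> 'a set) \<Rightarrow> ('m \<Rightarrow> 'a) set"
  where "sub_sections E K = {s \<in> sections E. \<forall>p. s p \<in> K p}"


section \<open>Lie algebroids and bundles of ideals\<close>

record ('m, 'a) algebroid = "('m, 'a) vbundle" +
  anchor :: "'m \<Rightarrow> 'a \<Rightarrow> ('m \<Rightarrow> real) \<Rightarrow> real"
  bracket :: "('m \<Rightarrow> 'a) \<Rightarrow> ('m \<Rightarrow> 'a) \<Rightarrow> 'm \<Rightarrow> 'a"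

definition anc :: "('m, 'a, 'z) algebroid_scheme \<Rightarrow> ('m \<Rightarrow> 'a) \<Rightarrow> 'm vfield"
  where "anc A \<alpha> = (\<lambda>p. anchor A p (\<alpha> p))"

(* The anchor is a bundle map A -> TM, given fibrewise. That it maps brackets to brackets is a
   consequence of the Jacobi identity and the Leibniz rule. *)

definition lie_algebroid ::
    "('m::{t2_space,second_countable_topology}, 'a::real_vector, 'z) algebroid_scheme \<Rightarrow> bool"
  where "lie_algebroid A \<longleftrightarrow> vector_bundle A \<and>
    (\<forall>p. \<forall>a \<in> fibre A p. anchor A p a \<in> tangent_space A p) \<and>
    (\<forall>p. \<forall>a \<in> fibre A p. \<forall>b \<in> fibre A p. \<forall>s t.
      anchor A p (s *\<^sub>R a + t *\<^sub>R b) = s *\<^sub>R anchor A p a + t *\<^sub>R anchor A p b) \<and>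
    (\<forall>\<alpha> \<in> sections A. anc A \<alpha> \<in> vfields A) \<and>
    (\<forall>\<alpha> \<in> sections A. \<forall>\<beta> \<in> sections A. bracket A \<alpha> \<beta> \<in> sections A) \<and>
    (\<forall>\<alpha> \<in> sections A. \<forall>\<beta> \<in> sections A. \<forall>\<gamma> \<in> sections A. \<forall>s t.
      bracket A \<alpha> (s *\<^sub>R \<beta> + t *\<^sub>R \<gamma>) = s *\<^sub>R bracket A \<alpha> \<beta> + t *\<^sub>R bracket A \<alpha> \<gamma>) \<and>
    (\<forall>\<alpha> \<in> sections A. \<forall>\<beta> \<in> sections A. bracket A \<alpha> \<beta> = - bracket A \<beta> \<alpha>) \<and>
    (\<forall>\<alpha> \<in> sections A. \<forall>\<beta> \<in> sections A. \<forall>\<gamma> \<in> sections A.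
      bracket A \<alpha> (bracket A \<beta> \<gamma>) + bracket A \<beta> (bracket A \<gamma> \<alpha>) + bracket A \<gamma> (bracket A \<alpha> \<beta>) = 0) \<and>
    (\<forall>\<alpha> \<in> sections A. \<forall>\<beta> \<in> sections A. \<forall>f \<in> smooth_funs A.
      bracket A \<alpha> (f \<odot> \<beta>) = f \<odot> bracket A \<alpha> \<beta> + vf_apply (anc A \<alpha>) f \<odot> \<beta>)"

definition bundle_of_ideals ::
    "('m::topological_space, 'a::real_vector, 'z) algebroid_scheme \<Rightarrow> ('m \<Rightarrow> 'a set) \<Rightarrow> bool"
  where "bundle_of_ideals A K \<longleftrightarrow> vector_subbundle A K \<and>
    (\<forall>p. \<forall>a \<in> K p. anchor A p a = 0) \<and>
    (\<forall>\<alpha> \<in> sections A. \<forall>\<xi> \<in> sub_sections A K. bracket A \<alpha> \<xi> \<in> sub_sections A K)"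


section \<open>Differential forms with values in K\<close>

(* A q-form is an alternating multilinear map, over the ring of smooth functions, from q vector
   fields to sections of K. The arguments form a list [X_0, ..., X_(q-1)]; the value 0 on all other
   lists only makes the representation by total functions unique, and makes the contraction of a
   0-form vanish. *)

type_synonym ('m, 'a) vform = "'m vfield list \<Rightarrow> 'm \<Rightarrow> 'a"

definition forms ::
    "('m, 'a::real_vector, 'z) vbundle_scheme \<Rightarrow> ('m \<Rightarrow> 'a set) \<Rightarrow> nat \<Rightarrow> ('m, 'a) vform set"
  where "forms E K q = {\<omega>.
    (\<forall>Xs. length Xs = q \<and> set Xs \<subseteq> vfields E \<longrightarrow> \<omega> Xs \<in> sub_sections E K) \<and>
    (\<forall>Xs i. length Xs = q \<and> set Xs \<subseteq> vfields E \<and> i < q \<longrightarrow>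
      (\<forall>X \<in> vfields E. \<forall>Y \<in> vfields E. \<forall>f \<in> smooth_funs E. \<forall>g \<in> smooth_funs E.
        \<omega> (Xs[i := f \<odot> X + g \<odot> Y]) = f \<odot> \<omega> (Xs[i := X]) + g \<odot> \<omega> (Xs[i := Y]))) \<and>
    (\<forall>Xs i j. length Xs = q \<and> set Xs \<subseteq> vfields E \<and> i < j \<and> j < q \<and> Xs ! i = Xs ! j \<longrightarrow> \<omega> Xs = 0) \<and>
    (\<forall>Xs. \<not> (length Xs = q \<and> set Xs \<subseteq> vfields E) \<longrightarrow> \<omega> Xs = 0)}"

definition omit :: "nat \<Rightarrow> 'b list \<Rightarrow> 'b list"
  where "omit i xs = take i xs @ drop (Suc i) xs"

definition on_vfields ::
    "('m, 'z) manifold_scheme \<Rightarrow> ('m, 'a::real_vector) vform \<Rightarrow> ('m, 'a) vform"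
  where "on_vfields M \<omega> = (\<lambda>Xs. if set Xs \<subseteq> vfields M then \<omega> Xs else 0)"

definition contract :: "'m vfield \<Rightarrow> ('m, 'a) vform \<Rightarrow> ('m, 'a) vform"
  where "contract X \<omega> = (\<lambda>Xs. \<omega> (X # Xs))"

definition fsmul :: "('m \<Rightarrow> real) \<Rightarrow> ('m, 'a::real_vector) vform \<Rightarrow> ('m, 'a) vform"
  where "fsmul f \<omega> = (\<lambda>Xs. f \<odot> \<omega> Xs)"

(* df /\ omega *)
definition d_wedge ::
    "('m, 'z) manifold_scheme \<Rightarrow> ('m \<Rightarrow> real) \<Rightarrow> ('m, 'a::real_vector) vform \<Rightarrow> ('m, 'a) vform"
  where "d_wedge M f \<omega> = on_vfields M (\<lambda>Xs.
    \<Sum>i<length Xs. (-1) ^ i *\<^sub>R (vf_apply (Xs ! i) f \<odot> \<omega> (omit i Xs)))"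

(* \<kappa> \<dot>\<wedge> \<theta> for a 1-form \<theta>; only the values of \<kappa> on sections of K enter, since \<theta> is K-valued. *)
definition dot_wedge ::
    "('m, 'z) manifold_scheme \<Rightarrow> (('m \<Rightarrow> 'a::real_vector) \<Rightarrow> ('m, 'a) vform) \<Rightarrow> ('m, 'a) vform \<Rightarrow>
      ('m, 'a) vform"
  where "dot_wedge M \<kappa> \<theta> = on_vfields M (\<lambda>Xs.
    \<Sum>i<length Xs. (-1) ^ i *\<^sub>R \<kappa> (\<theta> [Xs ! i]) (omit i Xs))"

(* The exterior covariant derivative, by the Koszul formula. *)
definition d_nabla ::
    "('m, 'z) manifold_scheme \<Rightarrow> ('m vfield \<Rightarrow> ('m \<Rightarrow> 'a::real_vector) \<Rightarrow> 'm \<Rightarrow> 'a) \<Rightarrow>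
      ('m, 'a) vform \<Rightarrow> ('m, 'a) vform"
  where "d_nabla M nabla \<omega> = on_vfields M (\<lambda>Xs.
    (\<Sum>i<length Xs. (-1) ^ i *\<^sub>R nabla (Xs ! i) (\<omega> (omit i Xs))) +
    (\<Sum>j<length Xs. \<Sum>i<j. (-1) ^ (i + j) *\<^sub>R
        \<omega> (vf_bracket (Xs ! i) (Xs ! j) # omit i (omit j Xs))))"

definition lie_der ::
    "('m, 'a::real_vector, 'z) algebroid_scheme \<Rightarrow> ('m \<Rightarrow> 'a) \<Rightarrow> ('m, 'a) vform \<Rightarrow> ('m, 'a) vform"
  where "lie_der A \<alpha> \<gamma> = on_vfields A (\<lambda>Xs. bracket A \<alpha> (\<gamma> Xs) -
    (\<Sum>j<length Xs. \<gamma> (Xs[j := vf_bracket (anc A \<alpha>) (Xs ! j)])))"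


section \<open>Infinitesimal multiplicative forms and connections\<close>

(* Pairs (c_0, c_1). As for forms, the components vanish outside sections A by convention. *)

type_synonym ('m, 'a) cochain =
  "(('m \<Rightarrow> 'a) \<Rightarrow> ('m, 'a) vform) \<times> (('m \<Rightarrow> 'a) \<Rightarrow> ('m, 'a) vform)"

(* Used for q >= 1 only. *)
definition weil ::
    "('m, 'a::real_vector, 'z) algebroid_scheme \<Rightarrow> ('m \<Rightarrow> 'a set) \<Rightarrow> nat \<Rightarrow> ('m, 'a) cochain set"
  where "weil A K q = {(c0, c1).
    (\<forall>\<alpha> \<in> sections A. c0 \<alpha> \<in> forms A K q \<and> c1 \<alpha> \<in> forms A K (q - 1)) \<and>
    (\<forall>\<alpha> \<in> sections A. \<forall>\<beta> \<in> sections A. \<forall>s t. c0 (s *\<^sub>R \<alpha> + t *\<^sub>R \<beta>) = s *\<^sub>R c0 \<alpha> + t *\<^sub>R c0 \<beta>) \<and>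
    (\<forall>\<alpha> \<in> sections A. \<forall>\<beta> \<in> sections A. \<forall>f \<in> smooth_funs A. \<forall>g \<in> smooth_funs A.
      c1 (f \<odot> \<alpha> + g \<odot> \<beta>) = fsmul f (c1 \<alpha>) + fsmul g (c1 \<beta>)) \<and>
    (\<forall>\<alpha> \<in> sections A. \<forall>f \<in> smooth_funs A.
      c0 (f \<odot> \<alpha>) = fsmul f (c0 \<alpha>) + d_wedge A f (c1 \<alpha>)) \<and>
    (\<forall>\<alpha>. \<alpha> \<notin> sections A \<longrightarrow> c0 \<alpha> = 0 \<and> c1 \<alpha> = 0)}"

definition im_forms ::
    "('m, 'a::real_vector, 'z) algebroid_scheme \<Rightarrow> ('m \<Rightarrow> 'a set) \<Rightarrow> nat \<Rightarrow> ('m, 'a) cochain set"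
  where "im_forms A K q = {(c0, c1). (c0, c1) \<in> weil A K q \<and>
    (\<forall>\<alpha> \<in> sections A. \<forall>\<beta> \<in> sections A.
      c0 (bracket A \<alpha> \<beta>) = lie_der A \<alpha> (c0 \<beta>) - lie_der A \<beta> (c0 \<alpha>) \<and>
      c1 (bracket A \<alpha> \<beta>) = lie_der A \<alpha> (c1 \<beta>) - contract (anc A \<beta>) (c0 \<alpha>) \<and>
      contract (anc A \<alpha>) (c1 \<beta>) = - contract (anc A \<beta>) (c1 \<alpha>))}"

definition im_forms_hor ::
    "('m, 'a::real_vector, 'z) algebroid_scheme \<Rightarrow> ('m \<Rightarrow> 'a set) \<Rightarrow> nat \<Rightarrow> ('m, 'a) cochain set"
  where "im_forms_hor A K q = {(c0, c1) \<in> im_forms A K q. \<forall>\<xi> \<in> sub_sections A K. c1 \<xi> = 0}"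

(* A 0-form \<omega> is identified with the section \<omega> []. *)

definition im_connections ::
    "('m, 'a::real_vector, 'z) algebroid_scheme \<Rightarrow> ('m \<Rightarrow> 'a set) \<Rightarrow> ('m, 'a) cochain set"
  where "im_connections A K = {(C, v) \<in> im_forms A K 1. \<forall>\<xi> \<in> sub_sections A K. v \<xi> [] = \<xi>}"

definition im_nabla :: "('m, 'a) cochain \<Rightarrow> 'm vfield \<Rightarrow> ('m \<Rightarrow> 'a) \<Rightarrow> 'm \<Rightarrow> 'a"
  where "im_nabla = (\<lambda>(C, v) X \<xi>. C \<xi> [X])"

definition hproj :: "('m, 'a::real_vector) cochain \<Rightarrow> ('m \<Rightarrow> 'a) \<Rightarrow> 'm \<Rightarrow> 'a"
  where "hproj = (\<lambda>(C, v) \<alpha>. \<alpha> - v \<alpha> [])"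

definition D_kappa ::
    "('m, 'z) manifold_scheme \<Rightarrow> ('m, 'a::real_vector) cochain \<Rightarrow> ('m, 'a) cochain \<Rightarrow>
      ('m \<Rightarrow> 'a) \<Rightarrow> ('m, 'a) vform"
  where "D_kappa M Cv c = (\<lambda>\<beta>. fst c \<beta> - d_nabla M (im_nabla Cv) (snd c \<beta>))"

definition D_im ::
    "('m, 'z) manifold_scheme \<Rightarrow> ('m, 'a::real_vector) cochain \<Rightarrow> ('m, 'a) cochain \<Rightarrow> ('m, 'a) cochain"
  where "D_im M Cv c =
    (\<lambda>\<alpha>. d_nabla M (im_nabla Cv) (fst c \<alpha>) - dot_wedge M (D_kappa M Cv c) (fst Cv \<alpha>),
     \<lambda>\<beta>. D_kappa M Cv c (hproj Cv \<beta>))"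

definition curvature ::
    "('m, 'z) manifold_scheme \<Rightarrow> ('m, 'a::real_vector) cochain \<Rightarrow> ('m, 'a) cochain"
  where "curvature M Cv = D_im M Cv Cv"

definition c2 ::
    "('m, 'z) manifold_scheme \<Rightarrow> ('m, 'a::real_vector) cochain \<Rightarrow> ('m, 'a) cochain"
  where "c2 M = (\<lambda>(L, l). (\<lambda>\<alpha>. - dot_wedge M L (L \<alpha>), \<lambda>\<alpha>. - L (l \<alpha> [])))"

end

theory Submission
  imports Defs
begin

text \<open>
  On sections \<open>\<xi>\<close> of the ideals the symbol \<open>l\<close> of a horizontal form vanishes. So \<open>L\<close> is function-linear
  there, and applying \<open>l\<close> to \<open>[\<xi>, \<beta>]\<close> gives \<open>L \<xi> (\<rho> \<beta>) = [\<xi>, l \<beta>]\<close>. With this identity the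
  equations for \<open>c2\<close> follow by applying \<open>L\<close> to those for \<open>(L, l)\<close>: the surplus terms are brackets
  of values of \<open>L\<close> and \<open>l\<close>, which cancel by skew symmetry.

  For the expansion, write \<open>(C', v') = (C, v) + t (L, l)\<close>. Since \<open>v'\<close> is the identity on the ideals,
  the map \<open>\<kappa>\<close> of \<open>(C', v')\<close> vanishes there and \<open>v' \<circ> h' = 0\<close>. Hence its curvature is
  \<open>(d\<^bsup>\<nabla>'\<^esup> \<circ> C', C' \<circ> h')\<close>, which is visibly quadratic in \<open>t\<close>.
\<close>

section \<open>Calculus of \<open>C_k\<close> along coordinate lines\<close>

section \<open>Smooth functions and sections\<close>

text \<open>\<open>W\<close> is the trace of an open set \<open>T\<close> of sequences on the
  subspace where the coordinates from \<open>n\<close> on vanish. Changing a coordinate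
  \<open>i < n\<close> stays in that subspace, so only \<open>T\<close> has to be respected.\<close>

lemma eventually_coordinate_line:
  assumes "openin (Euclidean_space n) W" and "x \<in> W" and "i < n"
  shows "eventually (\<lambda>t. x(i := t) \<in> W) (nhds (x i))"
proof -
  obtain T where T: "open T" "W = T \<inter> {x. \<forall>i\<ge>n. x i = 0}"
    using assms(1) unfolding Euclidean_space_def openin_subtopology
    by (auto simp: open_fun_def)
  have "continuous_on UNIV (\<lambda>t. x(i := t))"
  proof (rule continuous_on_coordinatewise_then_product)
    show "continuous_on UNIV (\<lambda>t. (x(i := t)) j)" for j
      by (cases "j = i") simp_all
  qed
  then have "open ((\<lambda>t. x(i := t)) -` T)"
    using T(1) by (simp add: open_vimage)
  moreover have "x i \<in> (\<lambda>t. x(i := t)) -` T"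
    using assms(2) T(2) by simp
  ultimately have "eventually (\<lambda>t. t \<in> (\<lambda>t. x(i := t)) -` T) (nhds (x i))"
    by (rule eventually_nhds_in_open)
  then show ?thesis
    by (rule eventually_mono) (use assms T(2) in auto)
qed

text \<open>The derivatives in \<open>C_k\<close> are those of total functions, whose values off
  \<open>W\<close> are arbitrary. Agreement on \<open>W\<close> passes to the partial derivatives
  because a coordinate line through a point of \<open>W\<close> stays in \<open>W\<close> for a
  while.\<close>

lemma C_k_cong:
  assumes W: "openin (Euclidean_space n) W"
  shows "C_k n k W f \<Longrightarrow> (\<And>x. x \<in> W \<Longrightarrow> f x = g x) \<Longrightarrow> C_k n k W g"
proof (induction k arbitrary: f g)
  case 0
  then show ?case by (simp cong: continuous_on_cong)
next
  case (Suc k)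
  have ev: "eventually (\<lambda>t. f (x(i := t)) = g (x(i := t))) (nhds (x i))" if "x \<in> W" "i < n" for x i
    using eventually_coordinate_line[OF W that] by (rule eventually_mono) (rule Suc.prems(2))
  have "(\<lambda>t. g (x(i := t))) differentiable (at (x i))" if x: "x \<in> W" "i < n" for x i
  proof -
    obtain D where "((\<lambda>t. f (x(i := t))) has_real_derivative D) (at (x i))"
      using Suc.prems(1) x by (auto simp only: C_k.simps real_differentiable_def)
    then have "((\<lambda>t. g (x(i := t))) has_real_derivative D) (at (x i))"
      by (rule DERIV_cong_ev[OF refl ev[OF x] refl, THEN iffD1])
    then show ?thesis by (auto simp only: real_differentiable_def)
  qed
  moreover have "C_k n k W (\<lambda>x. deriv (\<lambda>t. g (x(i := t))) (x i))" if i: "i < n" for i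
  proof (rule Suc.IH)
    show "C_k n k W (\<lambda>x. deriv (\<lambda>t. f (x(i := t))) (x i))"
      using Suc.prems(1) i by simp
    show "deriv (\<lambda>t. f (x(i := t))) (x i) = deriv (\<lambda>t. g (x(i := t))) (x i)" if "x \<in> W" for x
      by (rule deriv_cong_ev[OF ev[OF that i] refl])
  qed
  moreover have "continuous_on W g"
    using Suc.prems by (simp cong: continuous_on_cong)
  ultimately show ?case by simp
qed

lemma C_k_SucD: "C_k n (Suc k) W f \<Longrightarrow> C_k n k W f"
  by (induction k arbitrary: f) auto

lemma C_k_partial:
  "C_k n (Suc k) W f \<Longrightarrow> i < n \<Longrightarrow> C_k n k W (\<lambda>x. deriv (\<lambda>t. f (x(i := t))) (x i))"
  by simp

lemma C_k_has_partial:
  "C_k n (Suc k) W f \<Longrightarrow> i < n \<Longrightarrow> x \<in> W \<Longrightarrow>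
    ((\<lambda>t. f (x(i := t))) has_real_derivative deriv (\<lambda>t. f (x(i := t))) (x i)) (at (x i))"
  by (simp add: DERIV_deriv_iff_real_differentiable)

text \<open>\<open>V\<close> may be any subset: the partial derivatives are not taken relative to
  the set.\<close>

lemma C_k_subset: "C_k n k W f \<Longrightarrow> V \<subseteq> W \<Longrightarrow> C_k n k V f"
  by (induction k arbitrary: f) (auto intro: continuous_on_subset)

lemma C_k_const: "C_k n k W (\<lambda>x. c)"
  by (induction k arbitrary: c) simp_all

lemma C_k_add:
  assumes W: "openin (Euclidean_space n) W"
  shows "C_k n k W f \<Longrightarrow> C_k n k W g \<Longrightarrow> C_k n k W (\<lambda>x. f x + g x)"
proof (induction k arbitrary: f g)
  case 0
  then show ?case by (simp add: continuous_on_add)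
next
  case (Suc k)
  have "C_k n k W (\<lambda>x. deriv (\<lambda>t. f (x(i := t)) + g (x(i := t))) (x i))" if i: "i < n" for i
  proof (rule C_k_cong[OF W])
    show "C_k n k W (\<lambda>x. deriv (\<lambda>t. f (x(i := t))) (x i) + deriv (\<lambda>t. g (x(i := t))) (x i))"
      by (rule Suc.IH[OF Suc.prems[THEN C_k_partial, OF i]])
  next
    fix x assume "x \<in> W"
    from DERIV_imp_deriv[OF DERIV_add[OF Suc.prems[THEN C_k_has_partial, OF i this]]]
    show "deriv (\<lambda>t. f (x(i := t))) (x i) + deriv (\<lambda>t. g (x(i := t))) (x i) =
      deriv (\<lambda>t. f (x(i := t)) + g (x(i := t))) (x i)"
      by (rule sym)
  qed
  with Suc.prems show ?case by (simp add: continuous_on_add)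
qed

text \<open>Each term of the product rule has one factor differentiated and one not.
  \<open>C_k_SucD\<close> lowers the order of the latter, so that the induction hypothesis applies
  to both terms. The rule itself holds only on \<open>W\<close>, hence
  \<open>C_k_cong\<close>.\<close>

lemma C_k_mult:
  assumes W: "openin (Euclidean_space n) W"
  shows "C_k n k W f \<Longrightarrow> C_k n k W g \<Longrightarrow> C_k n k W (\<lambda>x. f x * g x)"
proof (induction k arbitrary: f g)
  case 0
  then show ?case by (simp add: continuous_on_mult)
next
  case (Suc k)
  have "C_k n k W (\<lambda>x. deriv (\<lambda>t. f (x(i := t)) * g (x(i := t))) (x i))" if i: "i < n" for i
  proof (rule C_k_cong[OF W])
    show "C_k n k W (\<lambda>x. deriv (\<lambda>t. f (x(i := t))) (x i) * g x + f x * deriv (\<lambda>t. g (x(i := t))) (x i))"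
      by (rule C_k_add[OF W Suc.IH[OF C_k_partial[OF Suc.prems(1) i] C_k_SucD[OF Suc.prems(2)]]
            Suc.IH[OF C_k_SucD[OF Suc.prems(1)] C_k_partial[OF Suc.prems(2) i]]])
  next
    fix x assume "x \<in> W"
    from DERIV_imp_deriv[OF DERIV_mult[OF Suc.prems[THEN C_k_has_partial, OF i this]]]
    show "deriv (\<lambda>t. f (x(i := t))) (x i) * g x + f x * deriv (\<lambda>t. g (x(i := t))) (x i) =
      deriv (\<lambda>t. f (x(i := t)) * g (x(i := t))) (x i)"
      \<comment> \<open>The product rule evaluates the undifferentiated factors at
        \<open>x(i := x i)\<close>, which is \<open>x\<close>.\<close>
      by (simp only: fun_upd_triv mult.commute)
  qed
  with Suc.prems show ?case by (simp add: continuous_on_mult)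
qed

section \<open>Smooth functions read in charts\<close>

lemma openin_chart_image:
  assumes "smooth_manifold M" and "(U, \<phi>) \<in> charts M" and "open S"
  shows "openin (Euclidean_space (mdim M)) (\<phi> ` (U \<inter> S))"
proof -
  have *: "openin (Euclidean_space (mdim M)) (\<phi> ` U)"
    "homeomorphic_map (top_of_set U) (subtopology (Euclidean_space (mdim M)) (\<phi> ` U)) \<phi>"
    using assms(1,2) unfolding smooth_manifold_def by auto
  have "openin (top_of_set U) (U \<inter> S)"
    using assms(3) by (simp add: openin_open_Int)
  then have "openin (subtopology (Euclidean_space (mdim M)) (\<phi> ` U)) (\<phi> ` (U \<inter> S))"
    using homeomorphic_imp_open_map[OF *(2)] by (simp add: open_map_def)
  then show ?thesis using *(1) by (rule openin_trans_full)
qed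

lemma chart_inj_on:
  assumes "smooth_manifold M" and "(U, \<phi>) \<in> charts M"
  shows "inj_on \<phi> U"
proof -
  have "homeomorphic_map (top_of_set U) (subtopology (Euclidean_space (mdim M)) (\<phi> ` U)) \<phi>"
    using assms unfolding smooth_manifold_def by auto
  from homeomorphic_imp_injective_map[OF this] show ?thesis by simp
qed

lemma smooth_fun_on_cong:
  assumes "smooth_manifold M" and "open S" and "smooth_fun_on M S f"
    and "\<And>p. p \<in> S \<Longrightarrow> f p = g p"
  shows "smooth_fun_on M S g"
  unfolding smooth_fun_on_def C_inf_def
proof (clarify)
  fix U \<phi> k assume c: "(U, \<phi>) \<in> charts M"
  show "C_k (mdim M) k (\<phi> ` (U \<inter> S)) (\<lambda>x. g (inv_into U \<phi> x))"
  proof (rule C_k_cong[OF openin_chart_image[OF assms(1) c assms(2)]])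
    show "C_k (mdim M) k (\<phi> ` (U \<inter> S)) (\<lambda>x. f (inv_into U \<phi> x))"
      using assms(3) c unfolding smooth_fun_on_def C_inf_def by blast
    show "f (inv_into U \<phi> x) = g (inv_into U \<phi> x)" if "x \<in> \<phi> ` (U \<inter> S)" for x
      using that assms(4) chart_inj_on[OF assms(1) c] by (auto simp: inv_into_f_f)
  qed
qed

text \<open>The coefficients are global, whereas \<open>a\<close> and \<open>b\<close> are smooth
  only over \<open>S\<close>: they will be components of sections in a trivialisation over
  \<open>S\<close>.\<close>

lemma smooth_fun_on_combination:
  assumes "smooth_manifold M" and "open S"
    and "smooth_fun_on M S a" and "smooth_fun_on M S b"
    and "smooth_fun_on M UNIV f" and "smooth_fun_on M UNIV g"
  shows "smooth_fun_on M S (\<lambda>p. f p * a p + g p * b p)"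
  unfolding smooth_fun_on_def C_inf_def
proof (clarify)
  fix U \<phi> k assume c: "(U, \<phi>) \<in> charts M"
  note W = openin_chart_image[OF assms(1) c assms(2)]
  have "C_k (mdim M) k (\<phi> ` (U \<inter> S)) (\<lambda>x. h (inv_into U \<phi> x))" if "smooth_fun_on M UNIV h" for h
    using that c unfolding smooth_fun_on_def C_inf_def by (blast intro: C_k_subset)
  with assms c show "C_k (mdim M) k (\<phi> ` (U \<inter> S))
      (\<lambda>x. f (inv_into U \<phi> x) * a (inv_into U \<phi> x) + g (inv_into U \<phi> x) * b (inv_into U \<phi> x))"
    unfolding smooth_fun_on_def C_inf_def by (intro C_k_add[OF W] C_k_mult[OF W]) blast+
qed

section \<open>Sections as a module over the smooth functions\<close>

lemma smooth_funs_const: "(\<lambda>_. c) \<in> smooth_funs M"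
  by (auto simp: smooth_funs_def smooth_fun_on_def C_inf_def C_k_const)

lemma smul_const: "(\<lambda>_. c) \<odot> s = c *\<^sub>R s"
  by (simp add: smul_def scaleR_fun_def)

text \<open>A trivialisation is linear on the fibres over its domain \<open>V\<close> only. The
  components of the combination are therefore compared with the combination of components on the
  open set \<open>V\<close>.\<close>

lemma sections_combination:
  assumes E: "vector_bundle E" and s: "s \<in> sections E" "s' \<in> sections E"
    and f: "f \<in> smooth_funs E" "g \<in> smooth_funs E"
  shows "f \<odot> s + g \<odot> s' \<in> sections E"
proof -
  have M: "smooth_manifold E" using E by (simp add: vector_bundle_def)
  have fib: "s p \<in> fibre E p" "s' p \<in> fibre E p" for p
    using s by (simp_all add: sections_def local_section_def)
  have "smooth_fun_on E V (\<lambda>p. \<phi> p (f p *\<^sub>R s p + g p *\<^sub>R s' p) i)"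
    if V: "(V, \<phi>) \<in> trivs E" and i: "i < brank E" for V \<phi> i
  proof (rule smooth_fun_on_cong[OF M])
    show "open V" using E V by (auto simp: vector_bundle_def)
    show "smooth_fun_on E V (\<lambda>p. f p * \<phi> p (s p) i + g p * \<phi> p (s' p) i)"
      using s f V i
      by (intro smooth_fun_on_combination[OF M \<open>open V\<close>])
        (auto simp: sections_def local_section_def smooth_funs_def)
    fix p assume "p \<in> V"
    with E V fib have "\<phi> p (f p *\<^sub>R s p + g p *\<^sub>R s' p) = f p *\<^sub>R \<phi> p (s p) + g p *\<^sub>R \<phi> p (s' p)"
      by (fastforce simp: vector_bundle_def)
    then show "f p * \<phi> p (s p) i + g p * \<phi> p (s' p) i = \<phi> p (f p *\<^sub>R s p + g p *\<^sub>R s' p) i"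
      by (simp add: scaleR_fun_def)
  qed
  moreover have "f p *\<^sub>R s p + g p *\<^sub>R s' p \<in> fibre E p" for p
    using E fib by (simp add: vector_bundle_def subspace_add subspace_scale)
  ultimately show ?thesis
    by (auto simp: sections_def local_section_def smul_def)
qed

lemma vector_subbundle_subspace: "vector_subbundle E K \<Longrightarrow> subspace (K p)"
  unfolding vector_subbundle_def by (metis subspace_span)

lemma sub_sections_combination:
  assumes "vector_bundle E" and "vector_subbundle E K"
    and "s \<in> sub_sections E K" "s' \<in> sub_sections E K"
    and "f \<in> smooth_funs E" "g \<in> smooth_funs E"
  shows "f \<odot> s + g \<odot> s' \<in> sub_sections E K"
  using assms sections_combination[OF assms(1)] vector_subbundle_subspace[OF assms(2)]
  by (simp add: sub_sections_def) (simp add: smul_def subspace_add subspace_scale)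

lemma omit_simps [simp]: "omit 0 (x # xs) = xs" "omit (Suc i) (x # xs) = x # omit i xs"
  by (simp_all add: omit_def)

lemma length_omit: "i < length xs \<Longrightarrow> length (omit i xs) = length xs - 1"
  by (simp add: omit_def)

lemma zero_section:
  assumes E: "vector_bundle E"
  shows "0 \<in> sections E"
proof -
  have M: "smooth_manifold E" using E by (simp add: vector_bundle_def)
  have "smooth_fun_on E V (\<lambda>p. \<phi> p 0 i)" if V: "(V, \<phi>) \<in> trivs E" and i: "i < brank E" for V \<phi> i
  proof (rule smooth_fun_on_cong[OF M])
    show "open V" using E V by (auto simp: vector_bundle_def)
    show "smooth_fun_on E V (\<lambda>_. 0)"
      by (auto simp: smooth_fun_on_def C_inf_def C_k_const)
    fix p assume "p \<in> V"
    moreover have "0 \<in> fibre E p" using E by (simp add: vector_bundle_def subspace_0)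
    \<comment> \<open>Fibrewise linearity is given for combinations of two vectors; both
      coefficients zero yields \<open>\<phi> p 0 = 0\<close>.\<close>
    ultimately have "\<phi> p (0 *\<^sub>R 0 + 0 *\<^sub>R 0) = 0 *\<^sub>R \<phi> p 0 + 0 *\<^sub>R \<phi> p 0"
      using E V unfolding vector_bundle_def by blast
    then show "0 = \<phi> p 0 i" by simp
  qed
  then show ?thesis
    using E by (auto simp: sections_def local_section_def vector_bundle_def subspace_0)
qed

section \<open>Equality of forms through their values on short lists\<close>

section \<open>Forms as functions on lists\<close>

lemma smul_simps [simp]:
  "(0 :: 'm \<Rightarrow> real) \<odot> s = 0" "f \<odot> (0 :: 'm \<Rightarrow> 'b::real_vector) = 0"
  "f \<odot> (- s) = - (f \<odot> s)"
  by (auto simp: smul_def fun_eq_iff zero_fun_def)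

lemma fsmul_apply [simp]: "fsmul f \<omega> Xs = f \<odot> \<omega> Xs"
  by (simp add: fsmul_def)

lemma contract_apply [simp]: "contract X \<omega> Xs = \<omega> (X # Xs)"
  by (simp add: contract_def)

lemma smul_diff: "f \<odot> (s - s') = f \<odot> s - f \<odot> (s' :: 'm \<Rightarrow> 'b::real_vector)"
  by (simp add: smul_def fun_eq_iff algebra_simps)

lemma scaleR_fun_apply [simp]: "(r *\<^sub>R f) x = r *\<^sub>R f x"
  by (simp add: scaleR_fun_def)

text \<open>This isolates the default-value clause of \<open>forms\<close>. Two functions with this
  property are equal as soon as they agree on lists of \<open>q\<close> vector fields, and neither
  has to be known to be a form.\<close>

definition supported :: "('m, 'z) manifold_scheme \<Rightarrow> nat \<Rightarrow> ('m, 'a::real_vector) vform \<Rightarrow> bool"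
  where "supported M q \<omega> \<longleftrightarrow> (\<forall>Xs. \<not> (length Xs = q \<and> set Xs \<subseteq> vfields M) \<longrightarrow> \<omega> Xs = 0)"

lemma supportedD: "supported M q \<omega> \<Longrightarrow> \<not> (length Xs = q \<and> set Xs \<subseteq> vfields M) \<Longrightarrow> \<omega> Xs = 0"
  by (simp add: supported_def)

lemma supported_form: "\<omega> \<in> forms M K q \<Longrightarrow> supported M q \<omega>"
  unfolding forms_def supported_def by blast

lemma form_value:
  "\<omega> \<in> forms E K q \<Longrightarrow> length Xs = q \<Longrightarrow> set Xs \<subseteq> vfields E \<Longrightarrow> \<omega> Xs \<in> sub_sections E K"
  unfolding forms_def by simp

lemma supported_linear [intro]:
  "supported M q 0"
  "supported M q \<omega> \<Longrightarrow> supported M q \<eta> \<Longrightarrow> supported M q (\<omega> + \<eta>)"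
  "supported M q \<omega> \<Longrightarrow> supported M q \<eta> \<Longrightarrow> supported M q (\<omega> - \<eta>)"
  "supported M q \<omega> \<Longrightarrow> supported M q (- \<omega>)"
  "supported M q \<omega> \<Longrightarrow> supported M q (r *\<^sub>R \<omega>)"
  "supported M q \<omega> \<Longrightarrow> supported M q (fsmul f \<omega>)"
  by (simp_all add: supported_def fsmul_def)

lemma supported_on_vfields:
  assumes "\<And>Xs. length Xs \<noteq> q \<Longrightarrow> \<omega> Xs = 0"
  shows "supported M q (on_vfields M \<omega>)"
  using assms by (auto simp: supported_def on_vfields_def)

lemma supported_d_wedge:
  assumes "supported M q \<omega>"
  shows "supported M (Suc q) (d_wedge M f \<omega>)"
  unfolding d_wedge_def
proof (rule supported_on_vfields)
  fix Xs :: "'a vfield list"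
  assume "length Xs \<noteq> Suc q"
  then have "\<omega> (omit i Xs) = 0" if "i < length Xs" for i
    using that by (intro supportedD[OF assms]) (auto simp: length_omit)
  then show "(\<Sum>i<length Xs. (-1) ^ i *\<^sub>R (vf_apply (Xs ! i) f \<odot> \<omega> (omit i Xs))) = 0"
    by simp
qed

lemma supported_dot_wedge:
  assumes "\<And>\<xi>. supported M q (\<kappa> \<xi>)"
  shows "supported M (Suc q) (dot_wedge M \<kappa> \<theta>)"
  unfolding dot_wedge_def
proof (rule supported_on_vfields)
  fix Xs :: "'a vfield list"
  assume "length Xs \<noteq> Suc q"
  then have "\<kappa> \<xi> (omit i Xs) = 0" if "i < length Xs" for i \<xi>
    using that by (intro supportedD[OF assms]) (auto simp: length_omit)
  then show "(\<Sum>i<length Xs. (-1) ^ i *\<^sub>R \<kappa> (\<theta> [Xs ! i]) (omit i Xs)) = 0"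
    by simp
qed

text \<open>On a list of any length other than \<open>Suc q\<close>, every summand evaluates
  \<omega> at a list of the wrong length. Since \<open>nabla\<close> is an arbitrary function,
  \<open>nabla X 0 = 0\<close> has to be required.\<close>

lemma supported_d_nabla:
  assumes "supported M q \<omega>" and "\<And>X. nabla X 0 = 0"
  shows "supported M (Suc q) (d_nabla M nabla \<omega>)"
  unfolding d_nabla_def
proof (rule supported_on_vfields)
  fix Xs :: "'a vfield list"
  assume q: "length Xs \<noteq> Suc q"
  then have "\<omega> (omit i Xs) = 0" if "i < length Xs" for i
    using that by (intro supportedD[OF assms(1)]) (auto simp: length_omit)
  \<comment> \<open>Two entries are removed and the bracket is added, so the length drops by exactly
    one.\<close>
  moreover have "\<omega> (Z # omit i (omit j Xs)) = 0" if "j < length Xs" "i < j" for i j Z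
    using that q by (intro supportedD[OF assms(1)]) (auto simp: length_omit)
  ultimately show "(\<Sum>i<length Xs. (-1) ^ i *\<^sub>R nabla (Xs ! i) (\<omega> (omit i Xs))) +
    (\<Sum>j<length Xs. \<Sum>i<j. (-1) ^ (i + j) *\<^sub>R
        \<omega> (vf_bracket (Xs ! i) (Xs ! j) # omit i (omit j Xs))) = 0"
    using assms(2) by simp
qed

lemma supported_lie_der:
  assumes "supported A q \<omega>" and "bracket A \<alpha> 0 = 0"
  shows "supported A q (lie_der A \<alpha> \<omega>)"
  unfolding lie_der_def
proof (rule supported_on_vfields)
  fix Xs :: "'a vfield list"
  assume "length Xs \<noteq> q"
  then have "\<omega> Ys = 0" if "length Ys = length Xs" for Ys
    using that by (intro supportedD[OF assms(1)]) simp
  then show "bracket A \<alpha> (\<omega> Xs) -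
      (\<Sum>j<length Xs. \<omega> (Xs[j := vf_bracket (anc A \<alpha>) (Xs ! j)])) = 0"
    using assms(2) by simp
qed

lemma supported_contract: "supported M (Suc q) \<omega> \<Longrightarrow> supported M q (contract X \<omega>)"
  by (auto simp: supported_def contract_def)

lemmas supported_dot_wedge_1 = supported_dot_wedge[where q = 1, unfolded Suc_1]
  and supported_d_nabla_1 = supported_d_nabla[where q = 1, unfolded Suc_1]
  and supported_d_wedge_1 = supported_d_wedge[where q = 1, unfolded Suc_1]
  and supported_contract_1 = supported_contract[where q = 1, unfolded Suc_1]
  and supported_contract_0 = supported_contract[where q = 0, folded One_nat_def]

lemma supported_0_eqI:
  assumes "supported M 0 \<omega>" "supported M 0 \<eta>" and "\<omega> [] = \<eta> []"
  shows "\<omega> = \<eta>"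
proof
  fix Xs show "\<omega> Xs = \<eta> Xs"
    using assms by (cases Xs) (simp_all add: supported_def)
qed

lemma supported_1_eqI:
  assumes "supported M 1 \<omega>" "supported M 1 \<eta>"
    and "\<And>X. X \<in> vfields M \<Longrightarrow> \<omega> [X] = \<eta> [X]"
  shows "\<omega> = \<eta>"
proof
  fix Xs show "\<omega> Xs = \<eta> Xs"
  proof (cases "length Xs = 1 \<and> set Xs \<subseteq> vfields M")
    case True
    then show ?thesis using assms(3) by (auto simp: length_Suc_conv)
  qed (simp add: assms(1,2)[THEN supportedD])
qed

lemma supported_2_eqI:
  assumes "supported M 2 \<omega>" "supported M 2 \<eta>"
    and "\<And>X Y. X \<in> vfields M \<Longrightarrow> Y \<in> vfields M \<Longrightarrow> \<omega> [X, Y] = \<eta> [X, Y]"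
  shows "\<omega> = \<eta>"
proof
  fix Xs show "\<omega> Xs = \<eta> Xs"
  proof (cases "length Xs = 2 \<and> set Xs \<subseteq> vfields M")
    case True
    then show ?thesis using assms(3) by (auto simp: length_Suc_conv numeral_2_eq_2)
  qed (simp add: assms(1,2)[THEN supportedD])
qed

section \<open>Explicit formulas in degrees zero, one and two\<close>

lemma d_wedge_pair:
  "X \<in> vfields M \<Longrightarrow> Y \<in> vfields M \<Longrightarrow>
    d_wedge M f \<omega> [X, Y] = vf_apply X f \<odot> \<omega> [Y] - vf_apply Y f \<odot> \<omega> [X]"
  by (simp add: d_wedge_def on_vfields_def lessThan_Suc)

lemma dot_wedge_pair:
  "X \<in> vfields M \<Longrightarrow> Y \<in> vfields M \<Longrightarrow>
    dot_wedge M \<kappa> \<theta> [X, Y] = \<kappa> (\<theta> [X]) [Y] - \<kappa> (\<theta> [Y]) [X]"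
  by (simp add: dot_wedge_def on_vfields_def lessThan_Suc)

lemma d_nabla_pair:
  "X \<in> vfields M \<Longrightarrow> Y \<in> vfields M \<Longrightarrow>
    d_nabla M nabla \<omega> [X, Y] = nabla X (\<omega> [Y]) - nabla Y (\<omega> [X]) - \<omega> [vf_bracket X Y]"
  by (simp add: d_nabla_def on_vfields_def lessThan_Suc)

text \<open>On a 0-form the Koszul formula has a single term, \<nabla>_X applied to
  \<open>\<omega> []\<close>, and for \<open>im_nabla\<close> this is
  \<open>P (\<omega> []) [X]\<close>. So the derivative of the symbol in \<kappa> becomes an
  application of the leading term.\<close>

lemma d_nabla_zero_form:
  assumes "\<And>\<xi>. supported M 1 (P \<xi>)" and "P 0 = 0" and "supported M 0 \<omega>"
  shows "d_nabla M (im_nabla (P, p)) \<omega> = P (\<omega> [])"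
proof (rule supported_1_eqI)
  show "supported M 1 (d_nabla M (im_nabla (P, p)) \<omega>)"
    using supported_d_nabla[OF assms(3)] assms(2) by (simp add: im_nabla_def)
  show "supported M 1 (P (\<omega> []))" by (rule assms)
  show "d_nabla M (im_nabla (P, p)) \<omega> [X] = P (\<omega> []) [X]" if "X \<in> vfields M" for X
    using that by (simp add: d_nabla_def on_vfields_def im_nabla_def)
qed

lemma lie_der_single:
  "X \<in> vfields A \<Longrightarrow>
    lie_der A \<alpha> \<omega> [X] = bracket A \<alpha> (\<omega> [X]) - \<omega> [vf_bracket (anc A \<alpha>) X]"
  by (simp add: lie_der_def on_vfields_def)

lemma lie_der_pair:
  "X \<in> vfields A \<Longrightarrow> Y \<in> vfields A \<Longrightarrow>
    lie_der A \<alpha> \<omega> [X, Y] = bracket A \<alpha> (\<omega> [X, Y]) -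
      (\<omega> [vf_bracket (anc A \<alpha>) X, Y] + \<omega> [X, vf_bracket (anc A \<alpha>) Y])"
  by (simp add: lie_der_def on_vfields_def lessThan_Suc add.commute)

lemma d_wedge_single: "X \<in> vfields M \<Longrightarrow> d_wedge M f \<omega> [X] = vf_apply X f \<odot> \<omega> []"
  by (simp add: d_wedge_def on_vfields_def)

lemma form_twoI:
  assumes "supported E 2 \<omega>"
    and val: "\<And>X Y. X \<in> vfields E \<Longrightarrow> Y \<in> vfields E \<Longrightarrow> \<omega> [X, Y] \<in> sub_sections E K"
    and lin: "\<And>X Y Z f g. X \<in> vfields E \<Longrightarrow> Y \<in> vfields E \<Longrightarrow> Z \<in> vfields E \<Longrightarrow>
      f \<in> smooth_funs E \<Longrightarrow> g \<in> smooth_funs E \<Longrightarrow>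
      \<omega> [f \<odot> X + g \<odot> Y, Z] = f \<odot> \<omega> [X, Z] + g \<odot> \<omega> [Y, Z] \<and>
      \<omega> [Z, f \<odot> X + g \<odot> Y] = f \<odot> \<omega> [Z, X] + g \<odot> \<omega> [Z, Y]"
    and alt: "\<And>X. X \<in> vfields E \<Longrightarrow> \<omega> [X, X] = 0"
  shows "\<omega> \<in> forms E K 2"
proof -
  have pair: "\<exists>X\<in>vfields E. \<exists>Y\<in>vfields E. Xs = [X, Y]" if "length Xs = 2" "set Xs \<subseteq> vfields E" for Xs
    using that by (cases Xs; cases "tl Xs") auto
  show ?thesis
    unfolding forms_def mem_Collect_eq
  proof (intro conjI allI impI ballI; (elim conjE)?)
    fix Xs :: "'a vfield list" assume "length Xs = 2" "set Xs \<subseteq> vfields E"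
    then show "\<omega> Xs \<in> sub_sections E K" using pair[of Xs] val by auto
  next
    fix Xs :: "'a vfield list" and i :: nat and X Y f g
    assume Xs: "length Xs = 2" "set Xs \<subseteq> vfields E" and i: "i < 2"
      and *: "X \<in> vfields E" "Y \<in> vfields E" "f \<in> smooth_funs E" "g \<in> smooth_funs E"
    obtain X0 X1 where "X0 \<in> vfields E" "X1 \<in> vfields E" "Xs = [X0, X1]"
      using pair[OF Xs] by auto
    moreover have "i = 0 \<or> i = Suc 0" using i by auto
    ultimately show "\<omega> (Xs[i := f \<odot> X + g \<odot> Y]) = f \<odot> \<omega> (Xs[i := X]) + g \<odot> \<omega> (Xs[i := Y])"
      using lin[OF *(1,2) _ *(3,4)] by auto
  next
    fix Xs :: "'a vfield list" and i j :: nat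
    assume Xs: "length Xs = 2" "set Xs \<subseteq> vfields E" and ij: "i < j" "j < 2" "Xs ! i = Xs ! j"
    obtain X Y where XY: "X \<in> vfields E" "Xs = [X, Y]"
      using pair[OF Xs] by auto
    from ij have "i = 0" "j = Suc 0" by auto
    with XY ij(3) have "X = Y" by simp
    then show "\<omega> Xs = 0" using alt XY by simp
  next
    fix Xs assume "\<not> (length Xs = 2 \<and> set Xs \<subseteq> vfields E)"
    then show "\<omega> Xs = 0" by (rule supportedD[OF assms(1)])
  qed
qed

lemma form_one_combination:
  assumes "\<omega> \<in> forms E K 1" "X \<in> vfields E" "Y \<in> vfields E" "f \<in> smooth_funs E" "g \<in> smooth_funs E"
  shows "\<omega> [f \<odot> X + g \<odot> Y] = f \<odot> \<omega> [X] + g \<odot> \<omega> [Y]"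
proof -
  have "\<omega> ([X][0 := f \<odot> X + g \<odot> Y]) = f \<odot> \<omega> ([X][0 := X]) + g \<odot> \<omega> ([X][0 := Y])"
    using assms(1)[unfolded forms_def, THEN CollectD, THEN conjunct2, THEN conjunct1,
        rule_format, of "[X]" 0 X Y f g] assms(2-)
    by (simp only: list.size list.set) simp
  then show ?thesis by simp
qed

section \<open>Brackets with sections of the ideals\<close>

section \<open>Infinitesimal multiplicative forms\<close>

locale ideal_bundle =
  fixes A :: "('m::{t2_space,second_countable_topology}, 'a::real_vector) algebroid"
    and K :: "'m \<Rightarrow> 'a set"
  assumes algebroid: "lie_algebroid A"
    and ideals: "bundle_of_ideals A K"
begin

lemma underlying_bundle: "vector_bundle A" and underlying_subbundle: "vector_subbundle A K"
  using algebroid ideals by (simp_all add: lie_algebroid_def bundle_of_ideals_def)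

lemma sub_section: "\<xi> \<in> sub_sections A K \<Longrightarrow> \<xi> \<in> sections A"
  by (simp add: sub_sections_def)

lemma sections_diff: "\<alpha> \<in> sections A \<Longrightarrow> \<beta> \<in> sections A \<Longrightarrow> \<alpha> - \<beta> \<in> sections A"
  using sections_combination[OF underlying_bundle _ _ smooth_funs_const[of 1] smooth_funs_const[of "-1"]]
  by (simp add: smul_const)

lemma sub_sections_zero: "0 \<in> sub_sections A K"
  using zero_section[OF underlying_bundle] vector_subbundle_subspace[OF underlying_subbundle]
  by (simp add: sub_sections_def subspace_0)

lemma sub_sections_diff:
  "\<xi> \<in> sub_sections A K \<Longrightarrow> \<eta> \<in> sub_sections A K \<Longrightarrow> \<xi> - \<eta> \<in> sub_sections A K"
  using sub_sections_combination[OF underlying_bundle underlying_subbundle _ _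
      smooth_funs_const[of 1] smooth_funs_const[of "-1"]]
  by (simp add: smul_const)

lemma sub_sections_uminus: "\<xi> \<in> sub_sections A K \<Longrightarrow> - \<xi> \<in> sub_sections A K"
  using sub_sections_diff[OF sub_sections_zero] by simp

lemma sub_sections_smul:
  "\<xi> \<in> sub_sections A K \<Longrightarrow> f \<in> smooth_funs A \<Longrightarrow> f \<odot> \<xi> \<in> sub_sections A K"
  using sub_sections_combination[OF underlying_bundle underlying_subbundle _ sub_sections_zero _ smooth_funs_const]
  by simp

lemma sub_sections_add_scaled:
  "\<xi> \<in> sub_sections A K \<Longrightarrow> \<eta> \<in> sub_sections A K \<Longrightarrow> \<xi> + r *\<^sub>R \<eta> \<in> sub_sections A K"
  using sub_sections_combination[OF underlying_bundle underlying_subbundle _ _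
      smooth_funs_const[of 1] smooth_funs_const[of r]]
  by (simp add: smul_const)

lemma form_uminus:
  assumes "\<omega> \<in> forms A K q"
  shows "- \<omega> \<in> forms A K q"
  using assms unfolding forms_def by (simp add: sub_sections_uminus)

lemma vf_apply_smooth:
  "X \<in> vfields A \<Longrightarrow> f \<in> smooth_funs A \<Longrightarrow> vf_apply X f \<in> smooth_funs A"
  by (simp add: vfields_def)

lemma bracket_section: "\<alpha> \<in> sections A \<Longrightarrow> \<beta> \<in> sections A \<Longrightarrow> bracket A \<alpha> \<beta> \<in> sections A"
  using algebroid unfolding lie_algebroid_def by blast

lemma bracket_skew: "\<alpha> \<in> sections A \<Longrightarrow> \<beta> \<in> sections A \<Longrightarrow> bracket A \<alpha> \<beta> = - bracket A \<beta> \<alpha>"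
  using algebroid unfolding lie_algebroid_def by blast

lemma bracket_combination:
  "\<alpha> \<in> sections A \<Longrightarrow> \<beta> \<in> sections A \<Longrightarrow> \<gamma> \<in> sections A \<Longrightarrow>
    bracket A \<alpha> (s *\<^sub>R \<beta> + t *\<^sub>R \<gamma>) = s *\<^sub>R bracket A \<alpha> \<beta> + t *\<^sub>R bracket A \<alpha> \<gamma>"
  using algebroid unfolding lie_algebroid_def by blast

lemma bracket_diff:
  "\<alpha> \<in> sections A \<Longrightarrow> \<beta> \<in> sections A \<Longrightarrow> \<gamma> \<in> sections A \<Longrightarrow>
    bracket A \<alpha> (\<beta> - \<gamma>) = bracket A \<alpha> \<beta> - bracket A \<alpha> \<gamma>"
  using bracket_combination[of \<alpha> \<beta> \<gamma> 1 "-1"] by simp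

lemma bracket_zero: "\<alpha> \<in> sections A \<Longrightarrow> bracket A \<alpha> 0 = 0"
  using bracket_diff[of \<alpha> \<alpha> \<alpha>] by simp

lemma bracket_uminus:
  "\<alpha> \<in> sections A \<Longrightarrow> \<beta> \<in> sections A \<Longrightarrow> bracket A \<alpha> (- \<beta>) = - bracket A \<alpha> \<beta>"
  using bracket_diff[of \<alpha> 0 \<beta>] zero_section[OF underlying_bundle] by (simp add: bracket_zero)

lemma bracket_ideal:
  "\<alpha> \<in> sections A \<Longrightarrow> \<xi> \<in> sub_sections A K \<Longrightarrow> bracket A \<alpha> \<xi> \<in> sub_sections A K"
  using ideals by (simp add: bundle_of_ideals_def)

lemma bracket_ideal':
  "\<xi> \<in> sub_sections A K \<Longrightarrow> \<alpha> \<in> sections A \<Longrightarrow> bracket A \<xi> \<alpha> \<in> sub_sections A K"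
  by (subst bracket_skew) (auto intro: bracket_ideal sub_sections_uminus sub_section)

lemma anc_ideal: "\<xi> \<in> sub_sections A K \<Longrightarrow> anc A \<xi> = 0"
  using ideals by (simp add: bundle_of_ideals_def anc_def sub_sections_def fun_eq_iff)

text \<open>Since the anchor vanishes on \<open>K\<close>, this removes the Lie derivative terms
  along sections of \<open>K\<close>. One half of the commutator is \<open>X p 0\<close>, which is
  zero by linearity of the derivation \<open>X p\<close>.\<close>

lemma vf_bracket_zero:
  assumes "X \<in> vfields A"
  shows "vf_bracket 0 X = 0"
proof -
  have "X p 0 = 0" for p
  proof -
    have "0 \<in> smooth_funs A" using smooth_funs_const[of 0] by (simp add: zero_fun_def)
    moreover have "\<forall>f \<in> smooth_funs A. \<forall>g \<in> smooth_funs A. \<forall>s t.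
        X p (s *\<^sub>R f + t *\<^sub>R g) = s * X p f + t * X p g"
      using assms by (simp add: vfields_def tangent_space_def)
    ultimately have "X p (0 *\<^sub>R 0 + 0 *\<^sub>R 0) = 0 * X p 0 + 0 * X p 0" by blast
    then show ?thesis by simp
  qed
  then show ?thesis by (simp add: vf_bracket_def vf_apply_def fun_eq_iff zero_fun_def)
qed

lemma form_zero_arg:
  assumes "\<omega> \<in> forms A K 1" "X \<in> vfields A"
  shows "\<omega> [0] = 0"
  using form_one_combination[OF assms(1,2,2) smooth_funs_const[of 0] smooth_funs_const[of 0]]
  by (simp add: smul_const)

end

section \<open>Weil cochains in degree one, the common ground of the connection and the horizontal
  form\<close>

locale weil_1_cochain =
  ideal_bundle A K
    for A :: "('m::{t2_space,second_countable_topology}, 'a::real_vector) algebroid" and K +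
  fixes P p :: "('m \<Rightarrow> 'a) \<Rightarrow> ('m, 'a) vform"
  assumes weil: "(P, p) \<in> weil A K 1"
begin

lemma leading_form: "\<alpha> \<in> sections A \<Longrightarrow> P \<alpha> \<in> forms A K 1"
  and symbol_form: "\<alpha> \<in> sections A \<Longrightarrow> p \<alpha> \<in> forms A K 0"
  and not_section: "\<alpha> \<notin> sections A \<Longrightarrow> P \<alpha> = 0 \<and> p \<alpha> = 0"
  using weil unfolding weil_def mem_Collect_eq prod.case by auto

lemma supported_leading: "supported A 1 (P \<alpha>)"
  and supported_symbol: "supported A 0 (p \<alpha>)"
proof -
  show "supported A 1 (P \<alpha>)"
    using supported_form[OF leading_form]
    by (cases "\<alpha> \<in> sections A") (simp_all add: not_section supported_linear(1))
  show "supported A 0 (p \<alpha>)"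
    using supported_form[OF symbol_form]
    by (cases "\<alpha> \<in> sections A") (simp_all add: not_section supported_linear(1))
qed

text \<open>The default value 0 is itself a section of \<open>K\<close>, so there are no conditions
  on \<alpha> and \<open>Xs\<close>, and values of \<open>P\<close> can be fed into \<open>P\<close>
  again.\<close>

lemma leading_sub: "P \<alpha> Xs \<in> sub_sections A K"
proof (cases "\<alpha> \<in> sections A \<and> length Xs = 1 \<and> set Xs \<subseteq> vfields A")
  case True
  then show ?thesis by (auto intro: form_value leading_form)
next
  case False
  then have "P \<alpha> Xs = 0" using not_section[of \<alpha>] supportedD[OF supported_leading] by auto
  then show ?thesis by (simp add: sub_sections_zero)
qed

lemma symbol_sub: "p \<alpha> [] \<in> sub_sections A K"
proof (cases "\<alpha> \<in> sections A")
  case True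
  then show ?thesis by (auto intro: form_value symbol_form)
qed (simp add: not_section sub_sections_zero)

lemma leading_section: "P \<alpha> Xs \<in> sections A"
  and symbol_section: "p \<alpha> [] \<in> sections A"
  by (simp_all add: sub_section leading_sub symbol_sub)

lemma leading_combination:
  "\<alpha> \<in> sections A \<Longrightarrow> \<beta> \<in> sections A \<Longrightarrow> P (s *\<^sub>R \<alpha> + t *\<^sub>R \<beta>) = s *\<^sub>R P \<alpha> + t *\<^sub>R P \<beta>"
  using weil unfolding weil_def mem_Collect_eq prod.case by blast

lemma leading_diff: "\<alpha> \<in> sections A \<Longrightarrow> \<beta> \<in> sections A \<Longrightarrow> P (\<alpha> - \<beta>) = P \<alpha> - P \<beta>"
  using leading_combination[of \<alpha> \<beta> 1 "-1"] by simp

lemma leading_add_scaled: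
  "\<alpha> \<in> sections A \<Longrightarrow> \<beta> \<in> sections A \<Longrightarrow> P (\<alpha> + t *\<^sub>R \<beta>) = P \<alpha> + t *\<^sub>R P \<beta>"
  using leading_combination[of \<alpha> \<beta> 1 t] by simp

lemma leading_zero: "P 0 = 0"
  using leading_diff[OF zero_section[OF underlying_bundle] zero_section[OF underlying_bundle]] by simp

lemma leading_smul:
  "\<alpha> \<in> sections A \<Longrightarrow> f \<in> smooth_funs A \<Longrightarrow> P (f \<odot> \<alpha>) = fsmul f (P \<alpha>) + d_wedge A f (p \<alpha>)"
  using weil unfolding weil_def mem_Collect_eq prod.case by blast

lemma symbol_combination:
  "\<alpha> \<in> sections A \<Longrightarrow> \<beta> \<in> sections A \<Longrightarrow> f \<in> smooth_funs A \<Longrightarrow> g \<in> smooth_funs A \<Longrightarrow>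
    p (f \<odot> \<alpha> + g \<odot> \<beta>) = fsmul f (p \<alpha>) + fsmul g (p \<beta>)"
  using weil unfolding weil_def mem_Collect_eq prod.case by blast

lemma symbol_diff: "\<alpha> \<in> sections A \<Longrightarrow> \<beta> \<in> sections A \<Longrightarrow> p (\<alpha> - \<beta>) = p \<alpha> - p \<beta>"
  using symbol_combination[OF _ _ smooth_funs_const[of 1] smooth_funs_const[of "-1"], of \<alpha> \<beta>]
  by (simp add: smul_const fsmul_def fun_eq_iff)

end

section \<open>Horizontal IM forms in degree one, evaluated on the ideals\<close>

locale horizontal_im_form =
  ideal_bundle A K
    for A :: "('m::{t2_space,second_countable_topology}, 'a::real_vector) algebroid" and K +
  fixes L l :: "('m \<Rightarrow> 'a) \<Rightarrow> ('m, 'a) vform"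
  assumes im_form: "(L, l) \<in> im_forms_hor A K 1"
begin

sublocale weil_1_cochain A K L l
  using im_form unfolding im_forms_hor_def im_forms_def mem_Collect_eq prod.case
  by unfold_locales blast

lemma horizontal: "\<xi> \<in> sub_sections A K \<Longrightarrow> l \<xi> = 0"
  using im_form unfolding im_forms_hor_def mem_Collect_eq prod.case by blast

lemma leading_bracket:
  "\<alpha> \<in> sections A \<Longrightarrow> \<beta> \<in> sections A \<Longrightarrow>
    L (bracket A \<alpha> \<beta>) = lie_der A \<alpha> (L \<beta>) - lie_der A \<beta> (L \<alpha>)"
  and symbol_bracket:
  "\<alpha> \<in> sections A \<Longrightarrow> \<beta> \<in> sections A \<Longrightarrow>
    l (bracket A \<alpha> \<beta>) = lie_der A \<alpha> (l \<beta>) - contract (anc A \<beta>) (L \<alpha>)"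
  using im_form unfolding im_forms_hor_def im_forms_def mem_Collect_eq prod.case by blast+

lemma symbol_bracket_value:
  "\<alpha> \<in> sections A \<Longrightarrow> \<beta> \<in> sections A \<Longrightarrow>
    l (bracket A \<alpha> \<beta>) [] = bracket A \<alpha> (l \<beta> []) - L \<alpha> [anc A \<beta>]"
  by (simp add: symbol_bracket lie_der_def on_vfields_def contract_def)

lemma leading_bracket_value:
  "\<alpha> \<in> sections A \<Longrightarrow> \<beta> \<in> sections A \<Longrightarrow> X \<in> vfields A \<Longrightarrow>
    L (bracket A \<alpha> \<beta>) [X] = bracket A \<alpha> (L \<beta> [X]) - L \<beta> [vf_bracket (anc A \<alpha>) X] -
      (bracket A \<beta> (L \<alpha> [X]) - L \<alpha> [vf_bracket (anc A \<beta>) X])"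
  by (simp add: leading_bracket lie_der_single)

text \<open>Because \<rho>(\<xi>) = 0, the Lie derivative along \<xi> reduces to the bracket with
  \<xi>.\<close>

lemma leading_bracket_ideal:
  "\<alpha> \<in> sections A \<Longrightarrow> \<xi> \<in> sub_sections A K \<Longrightarrow> X \<in> vfields A \<Longrightarrow>
    L (bracket A \<alpha> \<xi>) [X] = bracket A \<alpha> (L \<xi> [X]) - L \<xi> [vf_bracket (anc A \<alpha>) X] -
      bracket A \<xi> (L \<alpha> [X])"
  using form_zero_arg[OF leading_form]
  by (simp add: leading_bracket_value sub_section anc_ideal vf_bracket_zero)

text \<open>The bracket of \<xi> with \<beta> stays in \<open>K\<close>, so its symbol is zero and
  the two terms of \<open>symbol_bracket_value\<close> balance.\<close>

lemma leading_ideal_anchor: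
  assumes "\<xi> \<in> sub_sections A K" "\<beta> \<in> sections A"
  shows "L \<xi> [anc A \<beta>] = bracket A \<xi> (l \<beta> [])"
  using symbol_bracket_value[OF sub_section[OF assms(1)] assms(2)]
    horizontal[OF bracket_ideal'[OF assms]] by simp

text \<open>The defect from linearity is the wedge of df with \<open>l \<xi>\<close>, and
  \<open>l \<xi> = 0\<close>.\<close>

lemma leading_ideal_smul:
  assumes "\<xi> \<in> sub_sections A K" "f \<in> smooth_funs A"
  shows "L (f \<odot> \<xi>) = fsmul f (L \<xi>)"
proof -
  have "d_wedge A f 0 = (0 :: ('m, 'a) vform)"
    by (simp add: d_wedge_def on_vfields_def fun_eq_iff)
  then show ?thesis
    using leading_smul[OF sub_section[OF assms(1)] assms(2)] by (simp add: horizontal assms)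
qed

lemma leading_ideal_combination:
  assumes "\<xi> \<in> sub_sections A K" "\<eta> \<in> sub_sections A K" "f \<in> smooth_funs A" "g \<in> smooth_funs A"
  shows "L (f \<odot> \<xi> + g \<odot> \<eta>) = fsmul f (L \<xi>) + fsmul g (L \<eta>)"
  using leading_combination[of "f \<odot> \<xi>" "g \<odot> \<eta>" 1 1] assms
  by (simp add: leading_ideal_smul sub_sections_smul sub_section)

end

section \<open>The quadratic coefficient and the curvature\<close>

text \<open>All occurrences of \<kappa> are rewritten by \<open>d_nabla_zero_form\<close>. What
  remains of the covariant derivative is the one of the leading term.\<close>

lemma D_im_eq:
  assumes "\<And>\<xi>. supported M 1 (P \<xi>)" and "P 0 = 0" and "\<And>\<beta>. supported M 0 (q \<beta>)"
  shows "D_im M (P, p) (Q, q) =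
    (\<lambda>\<alpha>. d_nabla M (im_nabla (P, p)) (Q \<alpha>) - dot_wedge M (\<lambda>\<beta>. Q \<beta> - P (q \<beta> [])) (P \<alpha>),
     \<lambda>\<beta>. Q (\<beta> - p \<beta> []) - P (q (\<beta> - p \<beta> []) []))"
proof -
  have "d_nabla M (im_nabla (P, p)) (q \<beta>) = P (q \<beta> [])" for \<beta>
    by (rule d_nabla_zero_form) (rule assms)+
  then show ?thesis by (simp add: D_im_def D_kappa_def hproj_def)
qed

section \<open>The map \<open>c2\<close> takes values in horizontal IM 2-forms\<close>

context horizontal_im_form
begin

lemma not_vfield: "X \<notin> vfields A \<Longrightarrow> L \<alpha> [X] = 0"
  by (rule supportedD[OF supported_leading]) simp

text \<open>If \<open>X\<close> or \<open>Y\<close> is not a vector field, both sides vanish by the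
  default values and \<open>L 0 = 0\<close>. The formula thus applies directly to arguments such as
  \<open>vf_bracket (anc A \<alpha>) X\<close> or \<open>anc A \<beta>\<close>.\<close>

lemma dot_wedge_leading_pair:
  "dot_wedge A L (L \<alpha>) [X, Y] = L (L \<alpha> [X]) [Y] - L (L \<alpha> [Y]) [X]"
proof (cases "X \<in> vfields A \<and> Y \<in> vfields A")
  case True
  then show ?thesis by (simp add: dot_wedge_pair)
next
  case False
  then show ?thesis
    by (auto simp: dot_wedge_def on_vfields_def not_vfield leading_zero)
qed

lemma c2_pair: "(- dot_wedge A L (L \<alpha>)) [X, Y] = L (L \<alpha> [Y]) [X] - L (L \<alpha> [X]) [Y]"
  by (simp add: dot_wedge_leading_pair)

lemma supported_c2: "supported A 2 (- dot_wedge A L (L \<alpha>))"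
  by (intro supported_linear supported_dot_wedge_1 supported_leading)

lemma c2_leading_form:
  assumes "\<alpha> \<in> sections A"
  shows "- dot_wedge A L (L \<alpha>) \<in> forms A K 2"
proof (rule form_twoI[OF supported_c2])
  fix X Y Z f g
  assume *: "X \<in> vfields A" "Y \<in> vfields A" "Z \<in> vfields A" "f \<in> smooth_funs A" "g \<in> smooth_funs A"
  \<comment> \<open>Here the combination sits inside the inner value: the coefficients leave the
    form \<open>L \<alpha>\<close> first, and then leave the outer \<open>L\<close> because that is
    function-linear on \<open>K\<close>.\<close>
  have "L (L \<alpha> [f \<odot> X + g \<odot> Y]) [Z] = f \<odot> L (L \<alpha> [X]) [Z] + g \<odot> L (L \<alpha> [Y]) [Z]"
    using * by (simp add: form_one_combination[OF leading_form[OF assms]]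
        leading_ideal_combination leading_sub)
  moreover have "L (L \<alpha> [Z]) [f \<odot> X + g \<odot> Y] = f \<odot> L (L \<alpha> [Z]) [X] + g \<odot> L (L \<alpha> [Z]) [Y]"
    using * by (simp add: form_one_combination[OF leading_form[OF leading_section]])
  ultimately show "(- dot_wedge A L (L \<alpha>)) [f \<odot> X + g \<odot> Y, Z] =
      f \<odot> (- dot_wedge A L (L \<alpha>)) [X, Z] + g \<odot> (- dot_wedge A L (L \<alpha>)) [Y, Z] \<and>
    (- dot_wedge A L (L \<alpha>)) [Z, f \<odot> X + g \<odot> Y] =
      f \<odot> (- dot_wedge A L (L \<alpha>)) [Z, X] + g \<odot> (- dot_wedge A L (L \<alpha>)) [Z, Y]"
    unfolding c2_pair by (simp add: smul_diff algebra_simps)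
qed (simp_all only: c2_pair diff_self sub_sections_diff leading_sub)

lemma c2_symbol_form: "\<alpha> \<in> sections A \<Longrightarrow> - L (l \<alpha> []) \<in> forms A K 1"
  by (intro form_uminus leading_form symbol_section)

lemma c2_leading_combination:
  assumes "\<alpha> \<in> sections A" "\<beta> \<in> sections A"
  shows "- dot_wedge A L (L (s *\<^sub>R \<alpha> + t *\<^sub>R \<beta>)) =
    s *\<^sub>R (- dot_wedge A L (L \<alpha>)) + t *\<^sub>R (- dot_wedge A L (L \<beta>))"
proof (rule supported_2_eqI[OF supported_c2])
  show "supported A 2 (s *\<^sub>R (- dot_wedge A L (L \<alpha>)) + t *\<^sub>R (- dot_wedge A L (L \<beta>)))"
    by (intro supported_linear(2,5) supported_c2)
  show "(- dot_wedge A L (L (s *\<^sub>R \<alpha> + t *\<^sub>R \<beta>))) [X, Y] =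
    (s *\<^sub>R (- dot_wedge A L (L \<alpha>)) + t *\<^sub>R (- dot_wedge A L (L \<beta>))) [X, Y]" for X Y
    by (simp only: plus_fun_apply scaleR_fun_apply c2_pair)
      (simp add: leading_combination assms leading_section algebra_simps)
qed

lemma c2_symbol_combination:
  assumes "\<alpha> \<in> sections A" "\<beta> \<in> sections A" "f \<in> smooth_funs A" "g \<in> smooth_funs A"
  shows "- L (l (f \<odot> \<alpha> + g \<odot> \<beta>) []) = fsmul f (- L (l \<alpha> [])) + fsmul g (- L (l \<beta> []))"
  by (rule ext) (simp add: symbol_combination[OF assms] symbol_sub assms
      leading_ideal_combination)

text \<open>By the Leibniz rule the inner value \<open>L (f \<odot> \<alpha>) [Z]\<close> acquires
  the extra term (Zf) times \<open>l \<alpha> []\<close>. The outer \<open>L\<close> is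
  function-linear on it, and antisymmetrising in \<open>X\<close> and \<open>Y\<close> gives the
  wedge of df with \<open>- L (l \<alpha> [])\<close>.\<close>

lemma c2_leibniz:
  assumes "\<alpha> \<in> sections A" "f \<in> smooth_funs A"
  shows "- dot_wedge A L (L (f \<odot> \<alpha>)) =
    fsmul f (- dot_wedge A L (L \<alpha>)) + d_wedge A f (- L (l \<alpha> []))"
proof (rule supported_2_eqI[OF supported_c2])
  show "supported A 2 (fsmul f (- dot_wedge A L (L \<alpha>)) + d_wedge A f (- L (l \<alpha> [])))"
    by (intro supported_linear(2,6) supported_c2 supported_d_wedge_1 supported_linear(4) supported_leading)
  fix X Y assume X: "X \<in> vfields A" and Y: "Y \<in> vfields A"
  have "L (L (f \<odot> \<alpha>) [Z]) = fsmul f (L (L \<alpha> [Z])) + fsmul (vf_apply Z f) (L (l \<alpha> []))"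
    if "Z \<in> vfields A" for Z
    using that assms
    by (simp add: leading_smul d_wedge_single leading_ideal_combination leading_sub symbol_sub
        vf_apply_smooth)
  with X Y show "(- dot_wedge A L (L (f \<odot> \<alpha>))) [X, Y] =
    (fsmul f (- dot_wedge A L (L \<alpha>)) + d_wedge A f (- L (l \<alpha> []))) [X, Y]"
    by (simp only: plus_fun_apply fsmul_apply c2_pair d_wedge_pair)
      (simp add: smul_diff)
qed

text \<open>The bracket equation is applied twice. The brackets produced by the first application
  have an entry in \<open>K\<close>, so \<open>leading_bracket_ideal\<close> handles the
  second.\<close>

lemma leading_leading_bracket:
  assumes "\<alpha> \<in> sections A" "\<beta> \<in> sections A" "X \<in> vfields A" "Y \<in> vfields A"
  shows "L (L (bracket A \<alpha> \<beta>) [X]) [Y] =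
    bracket A \<alpha> (L (L \<beta> [X]) [Y]) - L (L \<beta> [X]) [vf_bracket (anc A \<alpha>) Y] -
      bracket A (L \<beta> [X]) (L \<alpha> [Y]) - L (L \<beta> [vf_bracket (anc A \<alpha>) X]) [Y] -
    (bracket A \<beta> (L (L \<alpha> [X]) [Y]) - L (L \<alpha> [X]) [vf_bracket (anc A \<beta>) Y] -
      bracket A (L \<alpha> [X]) (L \<beta> [Y]) - L (L \<alpha> [vf_bracket (anc A \<beta>) X]) [Y])"
  using assms
  by (simp add: leading_bracket_value[OF assms(1-3)] leading_diff sections_diff leading_section bracket_section
      leading_bracket_ideal leading_sub)

lemma c2_leading_bracket:
  assumes "\<alpha> \<in> sections A" "\<beta> \<in> sections A"
  shows "- dot_wedge A L (L (bracket A \<alpha> \<beta>)) =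
    lie_der A \<alpha> (- dot_wedge A L (L \<beta>)) - lie_der A \<beta> (- dot_wedge A L (L \<alpha>))"
proof (rule supported_2_eqI[OF supported_c2])
  show "supported A 2 (lie_der A \<alpha> (- dot_wedge A L (L \<beta>)) - lie_der A \<beta> (- dot_wedge A L (L \<alpha>)))"
    by (intro supported_linear(3) supported_lie_der supported_c2 bracket_zero assms)
  fix X Y assume XY: "X \<in> vfields A" "Y \<in> vfields A"
  \<comment> \<open>These are the brackets of two values of \<open>L\<close> that do not belong to
    the Lie derivatives. Skew symmetry cancels them in pairs once \<open>X\<close> and
    \<open>Y\<close> are antisymmetrised.\<close>
  have "bracket A (L \<beta> [X]) (L \<alpha> [Y]) = - bracket A (L \<alpha> [Y]) (L \<beta> [X])"
    "bracket A (L \<beta> [Y]) (L \<alpha> [X]) = - bracket A (L \<alpha> [X]) (L \<beta> [Y])"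
    by (intro bracket_skew leading_section)+
  then show "(- dot_wedge A L (L (bracket A \<alpha> \<beta>))) [X, Y] =
    (lie_der A \<alpha> (- dot_wedge A L (L \<beta>)) - lie_der A \<beta> (- dot_wedge A L (L \<alpha>))) [X, Y]"
    by (simp only: minus_apply lie_der_pair[OF XY] c2_pair
      leading_leading_bracket[OF assms XY] leading_leading_bracket[OF assms XY(2,1)]
      bracket_diff[OF assms(1) leading_section leading_section]
      bracket_diff[OF assms(2) leading_section leading_section]) simp
qed

text \<open>The extra bracket of \<open>l \<beta> []\<close> with \<open>L \<alpha> [X]\<close> does
  not cancel here. By \<open>leading_ideal_anchor\<close> it equals
  \<open>L (L \<alpha> [X]) [anc A \<beta>]\<close> up to sign, which is one of the two terms of the
  contraction.\<close>

lemma c2_symbol_bracket: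
  assumes "\<alpha> \<in> sections A" "\<beta> \<in> sections A"
  shows "- L (l (bracket A \<alpha> \<beta>) []) =
    lie_der A \<alpha> (- L (l \<beta> [])) - contract (anc A \<beta>) (- dot_wedge A L (L \<alpha>))"
proof (rule supported_1_eqI)
  show "supported A 1 (- L (l (bracket A \<alpha> \<beta>) []))"
    by (intro supported_linear(4) supported_leading)
  show "supported A 1 (lie_der A \<alpha> (- L (l \<beta> [])) - contract (anc A \<beta>) (- dot_wedge A L (L \<alpha>)))"
    by (intro supported_linear(3) supported_lie_der supported_contract_1 supported_c2
        supported_linear(4) supported_leading bracket_zero assms)
  fix X assume X: "X \<in> vfields A"
  have "L (L \<alpha> [X]) [anc A \<beta>] = - bracket A (l \<beta> []) (L \<alpha> [X])"
    unfolding leading_ideal_anchor[OF leading_sub assms(2)]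
    by (rule bracket_skew[OF leading_section symbol_section])
  moreover have "L (l (bracket A \<alpha> \<beta>) []) [X] =
      bracket A \<alpha> (L (l \<beta> []) [X]) - L (l \<beta> []) [vf_bracket (anc A \<alpha>) X] -
      bracket A (l \<beta> []) (L \<alpha> [X]) - L (L \<alpha> [anc A \<beta>]) [X]"
    by (simp only: symbol_bracket_value[OF assms] minus_apply
        leading_diff[OF bracket_section[OF assms(1) symbol_section] leading_section]
        leading_bracket_ideal[OF assms(1) symbol_sub X])
  ultimately show "(- L (l (bracket A \<alpha> \<beta>) [])) [X] =
    (lie_der A \<alpha> (- L (l \<beta> [])) - contract (anc A \<beta>) (- dot_wedge A L (L \<alpha>))) [X]"
    using bracket_uminus[OF assms(1) leading_section[of "l \<beta> []" "[X]"]]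
    by (intro ext) (simp add: lie_der_single X dot_wedge_leading_pair)
qed

text \<open>By \<open>leading_ideal_anchor\<close> both sides are brackets of
  \<open>l \<alpha> []\<close> and \<open>l \<beta> []\<close>, in opposite order and with opposite
  signs.\<close>

lemma c2_symbol_skew:
  assumes "\<alpha> \<in> sections A" "\<beta> \<in> sections A"
  shows "contract (anc A \<alpha>) (- L (l \<beta> [])) = - contract (anc A \<beta>) (- L (l \<alpha> []))"
proof (rule supported_0_eqI)
  show "supported A 0 (contract (anc A \<alpha>) (- L (l \<beta> [])))"
    by (intro supported_contract_0 supported_linear(4) supported_leading)
  show "supported A 0 (- contract (anc A \<beta>) (- L (l \<alpha> [])))"
    by (intro supported_contract_0 supported_linear(4) supported_leading)
  show "contract (anc A \<alpha>) (- L (l \<beta> [])) [] = (- contract (anc A \<beta>) (- L (l \<alpha> []))) []"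
    using bracket_skew[OF symbol_section symbol_section, of \<alpha> \<beta>]
    by (intro ext) (simp add: leading_ideal_anchor symbol_sub assms)
qed

lemma c2_in_im_forms_hor: "c2 A (L, l) \<in> im_forms_hor A K 2"
proof -
  have "dot_wedge A L 0 = 0"
    by (simp add: dot_wedge_def on_vfields_def leading_zero fun_eq_iff)
  then have "- dot_wedge A L (L \<alpha>) = 0" "- L (l \<alpha> []) = 0" if "\<alpha> \<notin> sections A" for \<alpha>
    using not_section[OF that] by (simp_all add: leading_zero)
  moreover have "- L (l \<xi> []) = 0" if "\<xi> \<in> sub_sections A K" for \<xi>
    using horizontal[OF that] by (simp add: leading_zero)
  \<comment> \<open>The degree is kept as \<open>2 - 1\<close>, the shape that
    \<open>weil A K 2\<close> demands of the symbol.\<close>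
  moreover have "- L (l \<alpha> []) \<in> forms A K (2 - 1)" if "\<alpha> \<in> sections A" for \<alpha>
    using c2_symbol_form[OF that] by simp
  ultimately show ?thesis
    unfolding c2_def im_forms_hor_def im_forms_def weil_def mem_Collect_eq prod.case
    by (intro conjI ballI allI impI c2_leading_form c2_leading_combination c2_symbol_combination
        c2_leibniz c2_leading_bracket c2_symbol_bracket c2_symbol_skew) assumption+
qed

section \<open>Expansion of the curvature in powers of \<open>t\<close>\<close>

lemma curvature_expansion:
  assumes conn: "(C, v) \<in> im_connections A K"
  shows "curvature A ((C, v) + t *\<^sub>R (L, l)) =
    curvature A (C, v) + t *\<^sub>R D_im A (C, v) (L, l) + t\<^sup>2 *\<^sub>R c2 A (L, l)"
proof -
  interpret C: weil_1_cochain A K C v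
    using conn unfolding im_connections_def im_forms_def mem_Collect_eq prod.case
    by unfold_locales blast
  have v: "v \<xi> [] = \<xi>" if "\<xi> \<in> sub_sections A K" for \<xi>
    using conn that unfolding im_connections_def mem_Collect_eq prod.case by blast
  define C' v' where C': "C' = C + t *\<^sub>R L" and v': "v' = v + t *\<^sub>R l"
  have C'_apply: "C' \<alpha> = C \<alpha> + t *\<^sub>R L \<alpha>" and v'_apply: "v' \<alpha> = v \<alpha> + t *\<^sub>R l \<alpha>" for \<alpha>
    by (simp_all add: C' v')
  have C'_supported: "supported A 1 (C' \<alpha>)" and v'_supported: "supported A 0 (v' \<alpha>)" for \<alpha>
    unfolding C'_apply v'_apply
    by (intro supported_linear(2,5) supported_leading supported_symbol
        C.supported_leading C.supported_symbol)+
  have C'_zero: "C' 0 = 0"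
    by (simp add: C'_apply leading_zero C.leading_zero)
  have v'_ideal: "v' \<xi> [] = \<xi>" if "\<xi> \<in> sub_sections A K" for \<xi>
    using that by (simp add: v'_apply v horizontal)
  have C'_sub: "C' \<alpha> Xs \<in> sub_sections A K" for \<alpha> Xs
    by (simp add: C'_apply sub_sections_add_scaled leading_sub C.leading_sub)
  note D' = D_im_eq[where P = C' and q = v', OF C'_supported C'_zero v'_supported]
    and D = D_im_eq[where P = C and q = v, OF C.supported_leading C.leading_zero C.supported_symbol]
    and DL = D_im_eq[where P = C and q = l, OF C.supported_leading C.leading_zero supported_symbol]

  have leading: "fst (D_im A (C', v') (C', v')) \<alpha> = fst (D_im A (C, v) (C, v)) \<alpha> +
      t *\<^sub>R fst (D_im A (C, v) (L, l)) \<alpha> + t\<^sup>2 *\<^sub>R (- dot_wedge A L (L \<alpha>))" for \<alpha>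
    unfolding D' D DL fst_conv
  proof (rule supported_2_eqI)
    have nabla: "im_nabla (C, v) X 0 = 0" "im_nabla (C', v') X 0 = 0" for X
      by (simp_all add: im_nabla_def C.leading_zero C'_zero)
    show "supported A 2 (d_nabla A (im_nabla (C', v')) (C' \<alpha>) -
        dot_wedge A (\<lambda>\<beta>. C' \<beta> - C' (v' \<beta> [])) (C' \<alpha>))"
      by (intro supported_linear(3) supported_d_nabla_1 supported_dot_wedge_1 C'_supported nabla)
    show "supported A 2 (d_nabla A (im_nabla (C, v)) (C \<alpha>) -
          dot_wedge A (\<lambda>\<beta>. C \<beta> - C (v \<beta> [])) (C \<alpha>) +
        t *\<^sub>R (d_nabla A (im_nabla (C, v)) (L \<alpha>) - dot_wedge A (\<lambda>\<beta>. L \<beta> - C (l \<beta> [])) (C \<alpha>)) +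
        t\<^sup>2 *\<^sub>R (- dot_wedge A L (L \<alpha>)))"
      by (intro supported_linear(2,3,5) supported_d_nabla_1 supported_dot_wedge_1
          C.supported_leading supported_leading supported_c2 nabla)
    fix X Y assume XY: "X \<in> vfields A" "Y \<in> vfields A"
    \<comment> \<open>This is the covariant derivative of \<open>C' \<alpha> [Z]\<close> before its
      direction is inserted. Of the terms linear in \<open>t\<close>,
      \<open>C (L \<alpha> [Z])\<close> belongs to the covariant derivative of
      \<open>L \<alpha>\<close>, and \<open>L (C \<alpha> [Z])\<close> to the dot wedge with
      \<open>C \<alpha>\<close>, since \<kappa> of \<open>(L, l)\<close> is \<open>L\<close> on
      \<open>K\<close>. The quadratic term antisymmetrises to \<open>c2\<close>.\<close>
    have "C' (C' \<alpha> [Z]) = C (C \<alpha> [Z]) + t *\<^sub>R C (L \<alpha> [Z]) + t *\<^sub>R L (C \<alpha> [Z]) + t\<^sup>2 *\<^sub>R L (L \<alpha> [Z])"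
      for Z
      by (simp add: C'_apply leading_add_scaled C.leading_add_scaled leading_section
          C.leading_section scaleR_add_right power2_eq_square)
    then show "(d_nabla A (im_nabla (C', v')) (C' \<alpha>) -
        dot_wedge A (\<lambda>\<beta>. C' \<beta> - C' (v' \<beta> [])) (C' \<alpha>)) [X, Y] =
      (d_nabla A (im_nabla (C, v)) (C \<alpha>) - dot_wedge A (\<lambda>\<beta>. C \<beta> - C (v \<beta> [])) (C \<alpha>) +
        t *\<^sub>R (d_nabla A (im_nabla (C, v)) (L \<alpha>) - dot_wedge A (\<lambda>\<beta>. L \<beta> - C (l \<beta> [])) (C \<alpha>)) +
        t\<^sup>2 *\<^sub>R (- dot_wedge A L (L \<alpha>))) [X, Y]"
      by (simp only: plus_fun_apply minus_apply scaleR_fun_apply c2_pair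
        d_nabla_pair[OF XY] dot_wedge_pair[OF XY] v'_ideal[OF C'_sub])
        (simp add: im_nabla_def v[OF C.leading_sub]
          horizontal[OF C.leading_sub] C.leading_zero C'_apply[of \<alpha>] algebra_simps)
  qed

  have symbol: "snd (D_im A (C', v') (C', v')) \<beta> = snd (D_im A (C, v) (C, v)) \<beta> +
      t *\<^sub>R snd (D_im A (C, v) (L, l)) \<beta> + t\<^sup>2 *\<^sub>R (- L (l \<beta> []))" for \<beta>
  proof (cases "\<beta> \<in> sections A")
    \<comment> \<open>Off the sections both symbols vanish, so the horizontal projections fix
      \<beta> and every term takes its default value.\<close>
    case False
    then show ?thesis
      unfolding D' D DL snd_conv
      by (simp add: C'_apply v'_apply not_section C.not_section leading_zero C.leading_zero)
  next
    case \<beta>: True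
    \<comment> \<open>\<eta> is the value of \<open>v'\<close> on \<beta>, so
      \<open>\<beta> - \<eta>\<close> is the new horizontal part h'\<beta> = h\<beta> - t
      l\<beta>.\<close>
    define \<eta> where "\<eta> = v \<beta> [] + t *\<^sub>R l \<beta> []"
    have \<eta>: "\<eta> \<in> sub_sections A K"
      by (simp add: \<eta>_def sub_sections_add_scaled symbol_sub C.symbol_sub)
    have v_zero: "v (\<beta> - v \<beta> []) [] = 0"
      by (simp add: C.symbol_diff \<beta> C.symbol_section v[OF C.symbol_sub])
    \<comment> \<open>Thus \<kappa> of \<open>(L, l)\<close> at h\<beta> is L(h\<beta>) -
      C(l\<beta>), the linear coefficient in the expansion of C'(h'\<beta>) below.\<close>
    have l_same: "l (\<beta> - v \<beta> []) = l \<beta>"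
      by (simp add: symbol_diff \<beta> C.symbol_section horizontal[OF C.symbol_sub])
    have "v' (\<beta> - \<eta>) [] = 0"
      by (simp add: v'_apply symbol_diff C.symbol_diff \<beta> sub_section[OF \<eta>] v[OF \<eta>]
          horizontal[OF \<eta>]) (simp add: \<eta>_def)
    moreover have "C' (\<beta> - \<eta>) =
      C (\<beta> - v \<beta> []) + t *\<^sub>R (L (\<beta> - v \<beta> []) - C (l \<beta> [])) + t\<^sup>2 *\<^sub>R (- L (l \<beta> []))"
      by (simp add: C'_apply leading_diff C.leading_diff \<beta> sub_section[OF \<eta>] C.symbol_section)
        (simp add: \<eta>_def leading_add_scaled C.leading_add_scaled symbol_section C.symbol_section
          algebra_simps power2_eq_square)
    moreover have "v' \<beta> [] = \<eta>" by (simp add: v'_apply \<eta>_def)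
    ultimately show ?thesis
      unfolding D' D DL snd_conv by (simp add: C'_zero v_zero l_same C.leading_zero)
  qed

  have "(C, v) + t *\<^sub>R (L, l) = (C', v')"
    by (simp add: C' v')
  then show ?thesis
    unfolding curvature_def by (simp only:) (simp add: prod_eq_iff fun_eq_iff c2_def leading symbol)
qed

end

theorem theorem5p19:
  fixes A :: "('m::{t2_space,second_countable_topology}, 'a::real_vector) algebroid"
    and K :: "'m \<Rightarrow> 'a set"
    and C v :: "('m \<Rightarrow> 'a) \<Rightarrow> ('m, 'a) vform"
  assumes "lie_algebroid A"
    and "bundle_of_ideals A K"
    and "(C, v) \<in> im_connections A K"
  shows "c2 A \<in> im_forms_hor A K 1 \<rightarrow> im_forms_hor A K 2 \<and>
    (\<forall>L l. (L, l) \<in> im_forms_hor A K 1 \<longrightarrow> (\<forall>t::real.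
      curvature A ((C, v) + t *\<^sub>R (L, l)) =
        curvature A (C, v) + t *\<^sub>R D_im A (C, v) (L, l) + t\<^sup>2 *\<^sub>R c2 A (L, l)))"
proof -
  have hor: "horizontal_im_form A K L l" if "(L, l) \<in> im_forms_hor A K 1" for L l
    using assms(1,2) that by unfold_locales
  have "c2 A c \<in> im_forms_hor A K 2" if "c \<in> im_forms_hor A K 1" for c
    using that horizontal_im_form.c2_in_im_forms_hor[OF hor, of "fst c" "snd c"] by simp
  then show ?thesis
    using horizontal_im_form.curvature_expansion[OF hor assms(3)] by blast
qed

end
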